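(* Let $\mathbf{M}$ be a Markov process with state space $(S,\mathcal{S})$ and transition function $p^{t}(x,dy)$, $t\in\mathbb{T}$, $x\in S$. Assume that there is $\pi\in\mathcal{P}(S)$ satisfying $$\lim_{t\to\infty}\ \sup_{s\in\mathbb{T}}\int_S d_W\big(p^{t}(y,dz),\pi(dz)\big)\,p^{s}(x,dy)=0\qquad\text{for every } x\in S.$$ For a function $f:S\to\mathbb{R}$ and $\mu\in\mathcal{P}(S)$ consider the property $$(\ast)\qquad \text{for every } p\ge1,\quad \frac{1}{t}\int_{[0,t)}f(M_s)\,\tau(ds)\longrightarrow \int_S f(y)\,\pi(dy)\ \text{ in } L^p(\Omega,\mathbb{P}^{\mu})\ \text{ as } t\nearrow\infty,\ t\in\mathbb{T}.$$ Then: (i) $(\ast)$ holds for all $f\in C_c(S)$ and all $\mu\in\mathcal{P}(S)$. In particular, if $S$ is compact, then $(\ast)$ holds for all $f\in C(S)$ and all $\mu\in\mathcal{P}(S)$. (ii) If $(S,d)$ is also a locally compact space, then $(\ast)$ holds for all $f\in C_\infty(S)$ and all $\mu\in\mathcal{P}(S)$. (iii) If $S$ is also a Hilbert space, then $(\ast)$ holds for all $f\in C_{b,u}(S)$ and all $\mu\in\mathcal{P}(S)$.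
   Context: State space: $(S,d)$ is a non-empty Polish space, i.e. $d$ is a complete and separable metric on $S$, $\mathcal{S}$ is its Borel $\sigma$-algebra, and $d$ is bounded by $1$: $\sup_{x,y\in S}d(x,y)\le 1$ (an unbounded metric is replaced by $d/(1+d)$ or $1\wedge d$; in particular, when $S$ is a Hilbert space with norm $\|\cdot\|$, $d$ is the metric obtained in this way from $\|x-y\|$). The time set $\mathbb{T}$ is either $\{0,1,2,\ldots\}$ or $[0,\infty)$, and $\tau$ is the counting measure on $\mathbb{T}$ in the first case and Lebesgue measure in the second. Process: $\mathbf{M}=(\Omega,\mathcal{F},\{\mathbb{P}^{x}\}_{x\in S},\{\mathcal{F}_t\}_{t\in\mathbb{T}},\{\theta_t\}_{t\in\mathbb{T}},\{M_t\}_{t\in\mathbb{T}})$ is a temporally homogeneous normal Markov process with state space $(S,\mathcal{S})$: each $(\Omega,\mathcal{F},\mathbb{P}^x)$ is a probability space; $\{\mathcal{F}_t\}$ is a filtration; $M_t:\Omega\to S$ is $\mathcal{F}_t/\mathcal{S}$-measurable; $\mathbb{P}^x(M_0=x)=1$ (normality); $x\mapsto\mathbb{P}^x(B)$ is $\mathcal{S}$-measurable for $B\in\mathcal{F}$; the shift operators $\theta_t:\Omega\to\Omega$ satisfy $M_t\circ\theta_s=M_{t+s}$; and the Markov property $\mathbb{P}^x(M_{t+s}\in B\mid\mathcal{F}_t)=p^s(M_t,B)$ $\mathbb{P}^x$-a.s. holds for all $s,t\in\mathbb{T}$, $x\in S$, $B\in\mathcal{S}$, where $p^{t}(x,dy):=\mathbb{P}^{x}(M_t\in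 dy)$ is the transition function. If $\mathbb{T}=[0,\infty)$, $\mathbf{M}$ is assumed progressively measurable: for each $t\ge0$ the map $(s,\omega)\mapsto M_s(\omega)$ from $[0,t]\times\Omega$ to $S$ is $\mathcal{B}([0,t])\times\mathcal{F}_t/\mathcal{S}$-measurable. $\mathcal{P}(S)$ is the set of probability measures on $\mathcal{S}$; for $\mu\in\mathcal{P}(S)$, $\mathbb{P}^\mu(d\omega):=\int_S\mathbb{P}^y(d\omega)\,\mu(dy)$. $Lip(S)$ is the space of all $f:S\to\mathbb{R}$ for which there is $L_f\ge0$ with $|f(x)-f(y)|\le L_f\,d(x,y)$ for all $x,y\in S$; the best constant is denoted $|f|_{Lip}$. The $L^1$-Wasserstein metric on $\mathcal{P}(S)$ is $$d_W(\mu,\nu):=\sup_{f\in Lip(S),\,|f|_{Lip}\le1}\left|\int_S f\,d\mu-\int_S f\,d\nu\right|.$$ The function $x\mapsto d_W(p^t(x,dy),\pi(dy))$ is $\mathcal{S}$-measurable for each $t\in\mathbb{T}$. $C(S)$, $C_c(S)$, $C_\infty(S)$ and $C_{b,u}(S)$ denote the spaces of real-valued functions on $S$ that are, respectively, continuous; continuous with compact support; continuous and vanishing at infinity; bounded and uniformly continuous (with respect to $d$). *)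

theory Defs
  imports "HOL-Probability.Probability"
begin

text \<open>
  The metric \<open>d\<close> on the state space is the \<open>dist\<close> of a type of class \<open>polish_space\<close>
  (complete metric, second countable topology); the probability measures on its Borel sets are
  \<open>space (prob_algebra borel)\<close>.
\<close>

definition transition ::
    "('s \<Rightarrow> 'w measure) \<Rightarrow> (real \<Rightarrow> 'w \<Rightarrow> 's::topological_space) \<Rightarrow> real \<Rightarrow> 's \<Rightarrow> 's measure" where
  "transition P M t x = distr (P x) borel (M t)"

text \<open>
  Both time sets are subsets of \<^typ>\<open>real\<close>; families indexed by time are only constrained on \<open>T\<close>.
  The measurable space \<open>(\<Omega>, \<F>)\<close> is the space and the \<open>\<sigma>\<close>-algebra of \<open>F\<close>, whose measure is irrelevant.
\<close>

locale markov_process =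
  fixes T :: "real set" and \<tau> :: "real measure"
    and F :: "'w measure" and Ft :: "real \<Rightarrow> 'w measure"
    and P :: "'s::polish_space \<Rightarrow> 'w measure"
    and \<theta> :: "real \<Rightarrow> 'w \<Rightarrow> 'w" and M :: "real \<Rightarrow> 'w \<Rightarrow> 's"
  assumes time:
      "(T = \<nat> \<and> \<tau> = count_space \<nat>) \<or> (T = {0..} \<and> \<tau> = restrict_space lborel {0..})"
    and prob: "\<And>x. prob_space (P x)"
    and sets_prob: "\<And>x. sets (P x) = sets F"
    and kernel: "\<And>B. B \<in> sets F \<Longrightarrow> (\<lambda>x. measure (P x) B) \<in> borel_measurable borel"
    and filtration_sub: "\<And>t. t \<in> T \<Longrightarrow> subalgebra F (Ft t)"
    and filtration_mono: "\<And>s t. s \<in> T \<Longrightarrow> t \<in> T \<Longrightarrow> s \<le> t \<Longrightarrow> sets (Ft s) \<subseteq> sets (Ft t)"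
    and adapted: "\<And>t. t \<in> T \<Longrightarrow> M t \<in> Ft t \<rightarrow>\<^sub>M borel"
    and normal: "\<And>x. measure (P x) {\<omega> \<in> space F. M 0 \<omega> = x} = 1"
    and shift_space: "\<And>t. t \<in> T \<Longrightarrow> \<theta> t \<in> space F \<rightarrow> space F"
    and shift: "\<And>s t \<omega>. s \<in> T \<Longrightarrow> t \<in> T \<Longrightarrow> \<omega> \<in> space F \<Longrightarrow> M t (\<theta> s \<omega>) = M (t + s) \<omega>"
    and markov: "\<And>s t x B. s \<in> T \<Longrightarrow> t \<in> T \<Longrightarrow> B \<in> sets borel \<Longrightarrow>
      AE \<omega> in P x. real_cond_exp (P x) (Ft t) (indicator {\<omega> \<in> space F. M (t + s) \<omega> \<in> B}) \<omega>
                   = measure (transition P M s (M t \<omega>)) B"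
    and progressive: "\<And>t. T = {0..} \<Longrightarrow> t \<in> T \<Longrightarrow>
      (\<lambda>(s, \<omega>). M s \<omega>) \<in> restrict_space borel {0..t} \<Otimes>\<^sub>M Ft t \<rightarrow>\<^sub>M borel"

definition Lip :: "('s::metric_space \<Rightarrow> real) set" where
  "Lip = {f. \<exists>L. L-lipschitz_on UNIV f}"

definition Lip_const :: "('s::metric_space \<Rightarrow> real) \<Rightarrow> real" where
  "Lip_const f = Inf {L. L-lipschitz_on UNIV f}"

text \<open>
  For probability measures and a bounded \<open>dist\<close> the supremum is over a bounded set of reals.
\<close>

definition d_W :: "'s::metric_space measure \<Rightarrow> 's measure \<Rightarrow> real" where
  "d_W \<mu> \<nu> = (SUP f\<in>{f \<in> Lip. Lip_const f \<le> 1}. \<bar>(\<integral>y. f y \<partial>\<mu>) - (\<integral>y. f y \<partial>\<nu>)\<bar>)"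

definition Lp_space :: "'w measure \<Rightarrow> real \<Rightarrow> ('w \<Rightarrow> real) set" where
  "Lp_space N p = {X \<in> borel_measurable N. integrable N (\<lambda>\<omega>. \<bar>X \<omega>\<bar> powr p)}"

definition Lp_norm :: "'w measure \<Rightarrow> real \<Rightarrow> ('w \<Rightarrow> real) \<Rightarrow> real" where
  "Lp_norm N p X = (\<integral>\<omega>. \<bar>X \<omega>\<bar> powr p \<partial>N) powr (1 / p)"

definition Lp_converges ::
    "'w measure \<Rightarrow> real \<Rightarrow> real set \<Rightarrow> (real \<Rightarrow> 'w \<Rightarrow> real) \<Rightarrow> ('w \<Rightarrow> real) \<Rightarrow> bool" where
  "Lp_converges N p T X Y \<longleftrightarrow>
     (\<forall>t\<in>T. X t \<in> Lp_space N p) \<and> Y \<in> Lp_space N p \<and>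
     ((\<lambda>t. Lp_norm N p (\<lambda>\<omega>. X t \<omega> - Y \<omega>)) \<longlongrightarrow> 0) (inf at_top (principal T))"

text \<open>
  The Giry bind \<open>\<mu> \<bind> P\<close> is the mixture \<open>\<integral> P y \<mu>(dy)\<close>.
\<close>

definition mean_ergodic ::
    "real set \<Rightarrow> real measure \<Rightarrow> ('s::topological_space \<Rightarrow> 'w measure) \<Rightarrow> (real \<Rightarrow> 'w \<Rightarrow> 's)
      \<Rightarrow> 's measure \<Rightarrow> ('s \<Rightarrow> real) \<Rightarrow> 's measure \<Rightarrow> bool" where
  "mean_ergodic T \<tau> P M \<pi> f \<mu> \<longleftrightarrow>
     (\<forall>p\<ge>1. Lp_converges (\<mu> \<bind> P) p T
              (\<lambda>t \<omega>. 1 / t * (LINT s:{0..<t}|\<tau>. f (M s \<omega>))) (\<lambda>_. \<integral>y. f y \<partial>\<pi>))"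

definition C :: "('s::topological_space \<Rightarrow> real) set" where
  "C = {f. continuous_on UNIV f}"

definition C_c :: "('s::topological_space \<Rightarrow> real) set" where
  "C_c = {f \<in> C. compact (closure {x. f x \<noteq> 0})}"

definition C_infty :: "('s::topological_space \<Rightarrow> real) set" where
  "C_infty = {f \<in> C. \<forall>e>0. \<exists>K. compact K \<and> (\<forall>x. x \<notin> K \<longrightarrow> \<bar>f x\<bar> < e)}"

definition C_bu :: "('s::metric_space \<Rightarrow> real) set" where
  "C_bu = {f. bounded (range f) \<and> uniformly_continuous_on UNIV f}"

text \<open>
  The metric of a Hilbert space type is unbounded, so it is not the \<open>dist\<close> of the state space
  itself. A Hilbert space structure on the state space is given by a bijection onto a Hilbert space
  type along which the vector space structure and inner product are transported; \<open>dist\<close> has to be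
  the bounded metric obtained from the transported norm.
\<close>

definition hilbert_structure ::
    "('s::metric_space \<Rightarrow> 'h::{real_inner, complete_space}) \<Rightarrow> bool" where
  "hilbert_structure \<phi> \<longleftrightarrow> bij \<phi> \<and>
     ((\<forall>x y. dist x y = norm (\<phi> x - \<phi> y) / (1 + norm (\<phi> x - \<phi> y))) \<or>
      (\<forall>x y. dist x y = min 1 (norm (\<phi> x - \<phi> y))))"

end

theory Submission
  imports Defs
begin

text \<open>
  All the function classes involved consist of bounded uniformly continuous functions, and such an
  \<open>f\<close> is a uniform limit of Lipschitz functions; hence for every \<open>e > 0\<close> there is \<open>L\<close> with
  \<open>\<bar>\<integral>f d\<mu> - \<integral>f d\<nu>\<bar> \<le> L d_W(\<mu>, \<nu>) + e\<close>. With \<open>g = f - \<integral>f d\<pi>\<close>, the Markov property bounds the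
  correlation of \<open>g (M r)\<close> and \<open>g (M (r + u))\<close> under \<open>P x\<close> by a constant times
  \<open>\<integral>\<bar>\<integral>f dp\<^sup>u(y) - \<integral>f d\<pi>\<bar> p\<^sup>r(x, dy)\<close>, which is small for large \<open>u\<close>, uniformly in \<open>r\<close>. Since the pairs of
  times in \<open>[0, t)\<close> at distance less than \<open>U\<close> have mass \<open>O(t)\<close>, the second moment of the time average of
  \<open>g\<close> vanishes as \<open>t\<close> grows. Dominated convergence in the initial point passes to \<open>\<mu> \<bind> P\<close>, and
  boundedness of \<open>f\<close> upgrades mean-square convergence to \<open>L\<^sup>p\<close>.
\<close>

section \<open>Test functions and the Wasserstein metric\<close>

text \<open>The infimum defining \<open>Lip_const\<close> is attained, because the Lipschitz
  inequality is closed in the constant: it holds with \<open>1 + e\<close> for every positive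
  \<open>e\<close>. So the supremum in \<open>d_W\<close> ranges over exactly the 1-Lipschitz
  functions.\<close>

lemma Lip_const_le_1_iff: "f \<in> Lip \<and> Lip_const f \<le> 1 \<longleftrightarrow> 1-lipschitz_on UNIV f"
proof
  assume f: "f \<in> Lip \<and> Lip_const f \<le> 1"
  show "1-lipschitz_on UNIV f"
  proof (rule lipschitz_onI)
    fix x y
    have "dist (f x) (f y) \<le> (1 + e) * dist x y" if "e > 0" for e :: real
    proof -
      have "Inf {L. L-lipschitz_on UNIV f} < 1 + e"
        using f that by (simp add: Lip_const_def)
      then obtain L where "L-lipschitz_on UNIV f" "L < 1 + e"
        using f cInf_lessD[of "{L. L-lipschitz_on UNIV f}"] by (auto simp: Lip_def)
      then show ?thesis
        using lipschitz_onD[of L UNIV f x y] mult_right_mono[of L "1 + e" "dist x y"] by auto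
    qed
    \<comment> \<open>The multiplicative slack is taken to be \<open>e / dist x y\<close>, which
      turns it into the additive slack \<open>e\<close>.\<close>
    then have "dist (f x) (f y) \<le> dist x y + e" if "e > 0" for e
    proof (cases "dist x y = 0")
      case False
      with that \<open>\<And>e. 0 < e \<Longrightarrow> dist (f x) (f y) \<le> (1 + e) * dist x y\<close>[of "e / dist x y"]
      show ?thesis by (simp add: field_simps zero_less_dist_iff)
    qed (use that in simp)
    then show "dist (f x) (f y) \<le> 1 * dist x y"
      by (simp add: field_le_epsilon)
  qed simp
next
  assume f: "1-lipschitz_on UNIV f"
  then have "Lip_const f \<le> 1"
    unfolding Lip_const_def by (intro cInf_lower) (auto intro!: bdd_belowI[of _ 0] lipschitz_on_nonneg)
  with f show "f \<in> Lip \<and> Lip_const f \<le> 1" by (auto simp: Lip_def)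
qed

text \<open>A real supremum dominates its members only if the set is bounded above. As the metric is
  bounded by 1, a 1-Lipschitz function stays within 1 of its value at any reference point, so two of
  its means differ by at most 2.\<close>

lemma d_W_upper:
  fixes f :: "'s::polish_space \<Rightarrow> real"
  assumes dist1: "\<forall>x y :: 's. dist x y \<le> 1"
    and \<mu>: "\<mu> \<in> space (prob_algebra borel)" and \<nu>: "\<nu> \<in> space (prob_algebra borel)"
    and f: "1-lipschitz_on UNIV f"
  shows "\<bar>(\<integral>y. f y \<partial>\<mu>) - (\<integral>y. f y \<partial>\<nu>)\<bar> \<le> d_W \<mu> \<nu>"
proof -
  have close: "\<bar>(\<integral>y. g y \<partial>M) - g x\<bar> \<le> 1"
    if g: "1-lipschitz_on UNIV g" and M: "M \<in> space (prob_algebra borel)"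
    for g :: "'s \<Rightarrow> real" and x M
  proof -
    interpret prob_space M using M by (simp add: space_prob_algebra)
    have [measurable_cong]: "sets M = sets borel" using M by (simp add: space_prob_algebra)
    have [measurable]: "g \<in> borel_measurable borel"
      using lipschitz_on_continuous_on[OF g] by (intro borel_measurable_continuous_onI)
    have b: "\<bar>g y - g x\<bar> \<le> 1" for y
      using lipschitz_onD[OF g, of y x] dist1[rule_format, of y x] by (simp add: dist_real_def)
    then have i: "integrable M (\<lambda>y. g y - g x)"
      by (intro integrable_const_bound[where B=1]) auto
    then have "\<bar>\<integral>y. g y - g x \<partial>M\<bar> \<le> 1"
      by (intro order_trans[OF integral_abs_bound] integral_le_const) (use b in auto)
    moreover have "integrable M g"
      using Bochner_Integration.integrable_add[OF i integrable_const[of "g x"]] by simp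
    ultimately show ?thesis by (simp add: prob_space)
  qed
  obtain x :: 's where True by simp
  show ?thesis unfolding d_W_def
  proof (rule cSUP_upper)
    show "f \<in> {f \<in> Lip. Lip_const f \<le> 1}" using f Lip_const_le_1_iff by auto
    show "bdd_above ((\<lambda>f. \<bar>(\<integral>y. f y \<partial>\<mu>) - (\<integral>y. f y \<partial>\<nu>)\<bar>) ` {f \<in> Lip. Lip_const f \<le> 1})"
    proof (rule bdd_aboveI2)
      fix g :: "'s \<Rightarrow> real" assume "g \<in> {f \<in> Lip. Lip_const f \<le> 1}"
      then have "1-lipschitz_on UNIV g" using Lip_const_le_1_iff by auto
      from close[OF this \<mu>, of x] close[OF this \<nu>, of x]
      show "\<bar>(\<integral>y. g y \<partial>\<mu>) - (\<integral>y. g y \<partial>\<nu>)\<bar> \<le> 2" by linarith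
    qed
  qed
qed

text \<open>An infimum of functions that are \<open>L\<close>-Lipschitz in \<open>x\<close> is again
  \<open>L\<close>-Lipschitz. It lies below \<open>f\<close>, and not far below: uniform continuity
  treats competitors \<open>y\<close> near \<open>x\<close>, boundedness those far away.\<close>

lemma C_bu_Lipschitz_approx:
  fixes f :: "'s::metric_space \<Rightarrow> real"
  assumes f: "f \<in> C_bu" and e: "e > 0"
  obtains L h where "L > 0" "L-lipschitz_on UNIV h" "\<And>x. \<bar>f x - h x\<bar> \<le> e"
proof -
  obtain B where B: "\<And>x. \<bar>f x\<bar> \<le> B"
    using f by (auto simp: C_bu_def bounded_iff)
  have "B \<ge> 0" using B[of undefined] by linarith
  obtain \<delta> where \<delta>: "\<delta> > 0" "\<And>x y. dist x y < \<delta> \<Longrightarrow> \<bar>f x - f y\<bar> < e"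
    using f e unfolding C_bu_def uniformly_continuous_on_def
    by (fastforce simp: dist_real_def dist_commute abs_minus_commute)
  \<comment> \<open>\<open>2 * B\<close> bounds the oscillation of \<open>f\<close>; the added 1
    keeps \<open>L\<close> positive even for \<open>B = 0\<close>.\<close>
  define L where "L = (2 * B + 1) / \<delta>"
  have L: "L > 0" using \<open>B \<ge> 0\<close> \<delta> by (simp add: L_def)
  \<comment> \<open>inf-convolution of \<open>f\<close> with \<open>L\<close> times the metric; \<open>L\<close> makes points at distance \<open>\<ge> \<delta>\<close> irrelevant\<close>
  define h where "h x = (INF y. f y + L * dist x y)" for x
  have bdd: "bdd_below (range (\<lambda>y. f y + L * dist x y))" for x
    by (rule bdd_belowI2[of _ "-B"]) (smt (verit) B L mult_nonneg_nonneg zero_le_dist)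
  have le: "h x \<le> h z + L * dist x z" for x z
  proof -
    have "h x - L * dist x z \<le> f y + L * dist z y" for y
    proof -
      have "h x \<le> f y + L * dist x y" unfolding h_def by (rule cINF_lower[OF bdd]) simp
      also have "L * dist x y \<le> L * dist x z + L * dist z y"
        using L dist_triangle[of x y z] by (simp flip: distrib_left)
      finally show ?thesis by simp
    qed
    then have "h x - L * dist x z \<le> h z" unfolding h_def[of z] by (intro cINF_greatest) auto
    then show ?thesis by simp
  qed
  have "L-lipschitz_on UNIV h"
  proof (rule lipschitz_onI)
    show "dist (h x) (h z) \<le> L * dist x z" for x z
      using le[of x z] le[of z x] by (simp add: dist_real_def dist_commute abs_le_iff)
  qed (use L in simp)
  moreover have "\<bar>f x - h x\<bar> \<le> e" for x
  proof -
    have "h x \<le> f x" unfolding h_def using cINF_lower[OF bdd, of x x] by simp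
    moreover have "f x - e \<le> f y + L * dist x y" for y
    proof (cases "dist x y < \<delta>")
      case True
      have "L * dist x y \<ge> 0" using L by simp
      then show ?thesis using \<delta>(2)[OF True] by linarith
    next
      case False
      then have "L * \<delta> \<le> L * dist x y" using L by simp
      then have "2 * B + 1 \<le> L * dist x y" using \<delta>(1) by (simp add: L_def)
      then show ?thesis using B[of x] B[of y] e by linarith
    qed
    then have "f x - e \<le> h x" unfolding h_def by (intro cINF_greatest) auto
    ultimately show ?thesis using e by linarith
  qed
  ultimately show ?thesis using that L by blast
qed

text \<open>Replacing \<open>f\<close> by a Lipschitz \<open>h\<close> costs \<open>e / 2\<close>
  for each of the two measures, and \<open>h / L\<close> is an admissible test function for
  \<open>d_W\<close>. The constant \<open>L\<close> depends on \<open>f\<close> and \<open>e\<close>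
  only, so it serves all transition laws at once.\<close>

lemma C_bu_d_W:
  fixes f :: "'s::polish_space \<Rightarrow> real"
  assumes dist1: "\<forall>x y :: 's. dist x y \<le> 1" and f: "f \<in> C_bu" and e: "e > 0"
  obtains L where "L > 0"
    "\<And>\<mu> \<nu>. \<mu> \<in> space (prob_algebra borel) \<Longrightarrow> \<nu> \<in> space (prob_algebra borel) \<Longrightarrow>
      \<bar>(\<integral>y. f y \<partial>\<mu>) - (\<integral>y. f y \<partial>\<nu>)\<bar> \<le> L * d_W \<mu> \<nu> + e"
proof -
  obtain L h where L: "L > 0" and h: "L-lipschitz_on UNIV h"
    and fh: "\<And>x. \<bar>f x - h x\<bar> \<le> e / 2"
    using C_bu_Lipschitz_approx[OF f, of "e / 2"] e by auto
  obtain B where B: "\<And>x. \<bar>f x\<bar> \<le> B"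
    using f by (auto simp: C_bu_def bounded_iff)
  have [measurable]: "f \<in> borel_measurable borel"
    using f by (auto simp: C_bu_def intro!: borel_measurable_continuous_onI uniformly_continuous_imp_continuous)
  have [measurable]: "h \<in> borel_measurable borel"
    using lipschitz_on_continuous_on[OF h] by (intro borel_measurable_continuous_onI)
  have fh_int: "\<bar>(\<integral>y. f y \<partial>M) - (\<integral>y. h y \<partial>M)\<bar> \<le> e / 2" if M: "M \<in> space (prob_algebra borel)" for M
  proof -
    interpret prob_space M using M by (simp add: space_prob_algebra)
    have [measurable_cong]: "sets M = sets borel" using M by (simp add: space_prob_algebra)
    have if': "integrable M f"
      by (rule integrable_const_bound[where B=B]) (use B in auto)
    have d: "integrable M (\<lambda>y. f y - h y)"
      by (rule integrable_const_bound[where B="e/2"]) (use fh in auto)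
    have ih: "integrable M h" using Bochner_Integration.integrable_diff[OF if' d] by simp
    have "\<bar>\<integral>y. f y - h y \<partial>M\<bar> \<le> e / 2"
      by (intro order_trans[OF integral_abs_bound] integral_le_const) (use d fh in auto)
    then show ?thesis using if' ih by simp
  qed
  have h1: "1-lipschitz_on UNIV (\<lambda>x. h x / L)"
    using lipschitz_onD[OF h] L
    by (intro lipschitz_onI) (auto simp: dist_real_def field_simps simp flip: diff_divide_distrib)
  show ?thesis
  proof (rule that[OF L])
    fix \<mu> \<nu> :: "'s measure"
    assume \<mu>: "\<mu> \<in> space (prob_algebra borel)" and \<nu>: "\<nu> \<in> space (prob_algebra borel)"
    have "\<bar>(\<integral>y. h y \<partial>\<mu>) - (\<integral>y. h y \<partial>\<nu>)\<bar> \<le> L * d_W \<mu> \<nu>"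
      using d_W_upper[OF dist1 \<mu> \<nu> h1] L by (simp add: field_simps flip: diff_divide_distrib)
    then show "\<bar>(\<integral>y. f y \<partial>\<mu>) - (\<integral>y. f y \<partial>\<nu>)\<bar> \<le> L * d_W \<mu> \<nu> + e"
      using fh_int[OF \<mu>] fh_int[OF \<nu>] by linarith
  qed
qed

section \<open>Inclusions between the function classes\<close>

text \<open>Off a compact set the values of \<open>f\<close> are small; on it, compactness gives
  boundedness and a Lebesgue number that serves as modulus of continuity.\<close>

lemma C_infty_subset_C_bu: "C_infty \<subseteq> (C_bu :: ('s::metric_space \<Rightarrow> real) set)"
proof
  fix f :: "'s \<Rightarrow> real" assume "f \<in> C_infty"
  then have cont: "continuous_on UNIV f"
    and van: "\<And>e. e > 0 \<Longrightarrow> \<exists>K. compact K \<and> (\<forall>x. x \<notin> K \<longrightarrow> \<bar>f x\<bar> < e)"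
    by (auto simp: C_infty_def C_def)
  obtain K where K: "compact K" "\<And>x. x \<notin> K \<Longrightarrow> \<bar>f x\<bar> < 1" using van[of 1] by auto
  have "bounded (f ` K)"
    using K cont by (intro compact_imp_bounded compact_continuous_image) (auto intro: continuous_on_subset)
  then obtain B where "\<And>x. x \<in> K \<Longrightarrow> \<bar>f x\<bar> \<le> B" by (auto simp: bounded_iff)
  then have "\<bar>f x\<bar> \<le> max B 1" for x using K(2)[of x] by (cases "x \<in> K") force+
  then have "bounded (range f)" by (auto simp: bounded_iff)
  moreover have "uniformly_continuous_on UNIV f"
    unfolding uniformly_continuous_on_def
  proof (intro allI impI)
    fix e :: real assume e: "e > 0"
    obtain K where K: "compact K" "\<And>x. x \<notin> K \<Longrightarrow> \<bar>f x\<bar> < e / 2" using van[of "e/2"] e by auto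
    \<comment> \<open>Two points of the same \<open>G z\<close> have values less than
      \<open>e\<close> apart, so a Lebesgue number of this open cover of \<open>K\<close> is the
      required \<delta>.\<close>
    define G where "G x = f -` ball (f x) (e / 2)" for x
    have cover: "K \<subseteq> \<Union> (range G)"
    proof
      fix x show "x \<in> \<Union> (range G)" using e by (intro UN_I[of x]) (auto simp: G_def)
    qed
    have "open A" if "A \<in> range G" for A
      using that cont by (auto simp: G_def continuous_on_open_vimage)
    from Heine_Borel_lemma[OF K(1) cover this]
    obtain d where d: "d > 0" "\<And>x. x \<in> K \<Longrightarrow> \<exists>A\<in>range G. ball x d \<subseteq> A"
      by metis
    \<comment> \<open>Only \<open>x\<close> has to lie in \<open>K\<close>: the whole ball around it
      is inside one member of the cover, which also settles pairs with just one point in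
      \<open>K\<close>.\<close>
    have near: "\<bar>f x - f y\<bar> < e" if x: "x \<in> K" and xy: "dist x y < d" for x y
    proof -
      obtain z where "ball x d \<subseteq> G z" using d(2)[OF x] by auto
      then have "x \<in> G z" "y \<in> G z" using xy d(1) by auto
      then have "dist (f z) (f x) < e / 2" "dist (f z) (f y) < e / 2" by (auto simp: G_def)
      then show ?thesis unfolding dist_real_def by linarith
    qed
    show "\<exists>d>0. \<forall>x\<in>UNIV. \<forall>x'\<in>UNIV. dist x' x < d \<longrightarrow> dist (f x') (f x) < e"
    proof (intro exI conjI ballI impI, rule d(1))
      fix x y :: 's assume xy: "dist y x < d"
      consider "x \<in> K" | "y \<in> K" | "x \<notin> K" "y \<notin> K" by blast
      then show "dist (f y) (f x) < e"
      proof cases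
        case 3
        then show ?thesis using K(2)[of x] K(2)[of y] unfolding dist_real_def by linarith
      qed (use near[of x y] near[of y x] xy in \<open>auto simp: dist_real_def dist_commute abs_minus_commute\<close>)
    qed
  qed
  ultimately show "f \<in> C_bu" by (simp add: C_bu_def)
qed

lemma C_c_subset_C_infty: "C_c \<subseteq> C_infty"
proof
  fix f assume f: "f \<in> C_c"
  moreover have "\<bar>f x\<bar> < e" if "x \<notin> closure {x. f x \<noteq> 0}" "e > 0" for x and e :: real
  proof -
    have "x \<notin> {x. f x \<noteq> 0}" using that(1) by (rule contra_subsetD[OF closure_subset])
    then show ?thesis using that(2) by simp
  qed
  ultimately show "f \<in> C_infty" by (auto simp: C_c_def C_infty_def)
qed

lemma C_subset_C_infty: "compact (UNIV :: 's::topological_space set) \<Longrightarrow> (C :: ('s \<Rightarrow> real) set) \<subseteq> C_infty"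
  by (auto simp: C_infty_def)

section \<open>Second moments of time integrals\<close>

text \<open>The square is a double integral over \<open>N\<close>, exchanged with the expectation by
  Fubini. For fixed \<open>s\<close>, the points of \<open>D s\<close> contribute at most
  \<open>b\<^sup>2\<close> each and have mass at most \<open>d\<close>; all others contribute at
  most \<open>e\<close>. In the application \<open>N\<close> is a time window and \<open>D s\<close>
  collects the times close to \<open>s\<close>.\<close>

lemma second_moment_le:
  fixes G :: "'a \<Rightarrow> 'b \<Rightarrow> real"
  assumes N: "finite_measure N" and Q: "prob_space Q"
    and G [measurable]: "case_prod G \<in> borel_measurable (N \<Otimes>\<^sub>M Q)"
    and b: "\<And>s \<omega>. \<bar>G s \<omega>\<bar> \<le> b"
    and D [measurable]: "\<And>s. s \<in> space N \<Longrightarrow> D s \<in> sets N"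
    and D_le: "\<And>s. s \<in> space N \<Longrightarrow> measure N (D s) \<le> d"
    and far: "\<And>s r. s \<in> space N \<Longrightarrow> r \<in> space N \<Longrightarrow> r \<notin> D s \<Longrightarrow> \<bar>\<integral>\<omega>. G r \<omega> * G s \<omega> \<partial>Q\<bar> \<le> e"
    and "e \<ge> 0"
  shows "(\<integral>\<omega>. (\<integral>s. G s \<omega> \<partial>N)\<^sup>2 \<partial>Q) \<le> measure N (space N) * (e * measure N (space N) + b\<^sup>2 * d)"
proof -
  interpret N: finite_measure N by fact
  interpret Q: prob_space Q by fact
  interpret NQ: pair_sigma_finite N Q ..
  interpret NQf: finite_measure "N \<Otimes>\<^sub>M Q" by (rule finite_measure_pair_measure) unfold_locales
  have [measurable]: "(\<lambda>\<omega>. G s \<omega>) \<in> borel_measurable Q" if "s \<in> space N" for s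
    using measurable_compose[OF measurable_Pair1'[OF that] G] by simp
  have [measurable]: "(\<lambda>s. G s \<omega>) \<in> borel_measurable N" if "\<omega> \<in> space Q" for \<omega>
    using measurable_compose[OF measurable_Pair2'[OF that] G] by simp
  have "b \<ge> 0" using b[of undefined undefined] by linarith
  define X where "X \<omega> = (\<integral>s. G s \<omega> \<partial>N)" for \<omega>
  have [measurable]: "X \<in> borel_measurable Q"
    unfolding X_def by measurable
  have X: "\<bar>X \<omega>\<bar> \<le> b * measure N (space N)" if "\<omega> \<in> space Q" for \<omega>
  proof -
    have "\<bar>X \<omega>\<bar> \<le> (\<integral>s. \<bar>G s \<omega>\<bar> \<partial>N)" unfolding X_def by (rule integral_abs_bound)
    also have "\<dots> \<le> (\<integral>s. b \<partial>N)"
      by (intro integral_mono N.integrable_const_bound[where B=b]) (use b that \<open>b \<ge> 0\<close> in auto)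
    finally show ?thesis by (simp add: mult.commute)
  qed
  \<comment> \<open>Only one factor of the square is expanded at a time: \<open>X\<close> is first
    correlated with \<open>G s\<close> for a fixed \<open>s\<close>.\<close>
  have XG: "(\<integral>\<omega>. X \<omega> * G s \<omega> \<partial>Q) \<le> e * measure N (space N) + b\<^sup>2 * d" if s: "s \<in> space N" for s
  proof -
    have GG: "integrable Q (\<lambda>\<omega>. G r \<omega> * G s \<omega>)" if "r \<in> space N" for r
      by (rule Q.integrable_const_bound[where B="b * b"])
        (use b s that \<open>b \<ge> 0\<close> in \<open>auto simp: abs_mult intro!: mult_mono\<close>)
    have [measurable]: "(\<lambda>z. G (fst z) (snd z) * G s (snd z)) \<in> borel_measurable (N \<Otimes>\<^sub>M Q)"
      using s G by (auto simp: split_beta' intro!: borel_measurable_times measurable_compose[OF measurable_snd])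
    have int: "integrable (N \<Otimes>\<^sub>M Q) (\<lambda>(r, \<omega>). G r \<omega> * G s \<omega>)"
      by (rule NQf.integrable_const_bound[where B="b * b"])
        (use b \<open>b \<ge> 0\<close> in \<open>auto simp: abs_mult split_beta' intro!: mult_mono\<close>)
    have "(\<integral>\<omega>. X \<omega> * G s \<omega> \<partial>Q) = (\<integral>\<omega>. (\<integral>r. G r \<omega> * G s \<omega> \<partial>N) \<partial>Q)"
      by (simp add: X_def)
    also have "\<dots> = (\<integral>r. (\<integral>\<omega>. G r \<omega> * G s \<omega> \<partial>Q) \<partial>N)"
      using NQ.Fubini_integral[OF int] by simp
    \<comment> \<open>\<open>e\<close> is charged for every \<open>r\<close> and
      \<open>b\<^sup>2\<close> on top for near ones; as \<open>e\<close> is nonnegative, the sum is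
      an upper bound in both cases.\<close>
    also have "\<dots> \<le> (\<integral>r. e + b\<^sup>2 * indicator (D s) r \<partial>N)"
    proof (rule integral_mono)
      show "integrable N (\<lambda>r. \<integral>\<omega>. G r \<omega> * G s \<omega> \<partial>Q)"
        using NQ.integrable_fst[OF int] by simp
      show "integrable N (\<lambda>r. e + b\<^sup>2 * indicator (D s) r)"
        using D[OF s] N.emeasure_finite[of "D s"]
        by (intro Bochner_Integration.integrable_add N.integrable_const integrable_mult_right
            integrable_real_indicator) (auto simp: less_top[symmetric])
      fix r assume r: "r \<in> space N"
      have "(\<integral>\<omega>. G r \<omega> * G s \<omega> \<partial>Q) \<le> b\<^sup>2"
      proof (rule Q.integral_le_const[OF GG[OF r]], rule AE_I2)
        fix \<omega>
        have "G r \<omega> * G s \<omega> \<le> \<bar>G r \<omega>\<bar> * \<bar>G s \<omega>\<bar>" by (simp flip: abs_mult)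
        also have "\<dots> \<le> b * b" by (intro mult_mono b \<open>b \<ge> 0\<close>) auto
        finally show "G r \<omega> * G s \<omega> \<le> b\<^sup>2" by (simp add: power2_eq_square)
      qed
      then show "(\<integral>\<omega>. G r \<omega> * G s \<omega> \<partial>Q) \<le> e + b\<^sup>2 * indicator (D s) r"
        using far[OF s r] \<open>e \<ge> 0\<close> by (cases "r \<in> D s") auto
    qed
    also have "\<dots> = e * measure N (space N) + b\<^sup>2 * measure N (D s)"
      using D[OF s] sets.sets_into_space[OF D[OF s]]
      by (subst Bochner_Integration.integral_add) (auto simp: Int_absorb2 N.emeasure_finite less_top[symmetric])
    also have "\<dots> \<le> e * measure N (space N) + b\<^sup>2 * d"
      using D_le[OF s] by (intro add_left_mono mult_left_mono) auto
    finally show ?thesis .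
  qed
  have int: "integrable (N \<Otimes>\<^sub>M Q) (\<lambda>(s, \<omega>). X \<omega> * G s \<omega>)"
    by (rule NQf.integrable_const_bound[where B="(b * measure N (space N)) * b"])
      (use b X \<open>b \<ge> 0\<close> in \<open>auto simp: abs_mult split_beta' space_pair_measure intro!: mult_mono\<close>)
  have "(\<integral>\<omega>. (X \<omega>)\<^sup>2 \<partial>Q) = (\<integral>\<omega>. (\<integral>s. X \<omega> * G s \<omega> \<partial>N) \<partial>Q)"
    by (simp add: X_def power2_eq_square)
  also have "\<dots> = (\<integral>s. (\<integral>\<omega>. X \<omega> * G s \<omega> \<partial>Q) \<partial>N)"
    using NQ.Fubini_integral[OF int] by simp
  also have "\<dots> \<le> (\<integral>s. e * measure N (space N) + b\<^sup>2 * d \<partial>N)"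
    using XG NQ.integrable_fst[OF int] by (intro integral_mono) auto
  finally show ?thesis by (simp add: X_def mult.commute)
qed

section \<open>Counting times and limits along the time set\<close>

text \<open>Discrete counterpart of the length \<open>2 * U\<close> of an interval: the integers
  between a ceiling and a floor number at most the length plus 1.\<close>

lemma card_Nats_interval_le:
  fixes s U :: real
  assumes "U \<ge> 0"
  shows "real (card (\<nat> \<inter> {s - U..s + U})) \<le> 2 * U + 1"
    and "finite (\<nat> \<inter> {s - U..s + U})"
proof -
  have sub: "\<nat> \<inter> {s - U..s + U} \<subseteq> real_of_int ` {\<lceil>s - U\<rceil>..\<lfloor>s + U\<rfloor>}"
  proof
    fix x assume x: "x \<in> \<nat> \<inter> {s - U..s + U}"
    then obtain n :: nat where "x = real n" by (auto elim: Nats_cases)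
    with x show "x \<in> real_of_int ` {\<lceil>s - U\<rceil>..\<lfloor>s + U\<rfloor>}"
      by (intro image_eqI[of _ _ "int n"]) (auto simp: ceiling_le_iff le_floor_iff)
  qed
  show "finite (\<nat> \<inter> {s - U..s + U})"
    by (rule finite_subset[OF sub]) simp
  have "card (\<nat> \<inter> {s - U..s + U}) \<le> card {\<lceil>s - U\<rceil>..\<lfloor>s + U\<rfloor>}"
    by (rule order_trans[OF card_mono[OF _ sub] card_image_le]) auto
  also have "\<dots> = nat (\<lfloor>s + U\<rfloor> - \<lceil>s - U\<rceil> + 1)" by simp
  finally have "real (card (\<nat> \<inter> {s - U..s + U})) \<le> real (nat (\<lfloor>s + U\<rfloor> - \<lceil>s - U\<rceil> + 1))"
    by simp
  also have "\<dots> \<le> 2 * U + 1"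
    using assms of_int_floor_le[of "s + U"] le_of_int_ceiling[of "s - U"] by (simp add: of_nat_nat) linarith
  finally show "real (card (\<nat> \<inter> {s - U..s + U})) \<le> 2 * U + 1" .
qed

lemma Nats_Int_lessThan: "\<nat> \<inter> {0..<real n} = real ` {..<n}"
  by (auto elim!: Nats_cases)

text \<open>If \<open>g\<close> left a neighbourhood of \<open>l\<close> at arbitrarily late times
  of \<open>T\<close>, choosing one such time beyond each \<open>n\<close> would give a sequence
  contradicting the assumption. This allows sequential dominated convergence to be used for limits
  along \<open>T\<close>.\<close>

lemma tendsto_inf_at_top_principalI:
  fixes g :: "real \<Rightarrow> 'a::topological_space"
  assumes "\<And>u. (\<And>n::nat. u n \<in> T) \<Longrightarrow> filterlim u (inf at_top (principal T)) sequentially \<Longrightarrow> (\<lambda>n. g (u n)) \<longlonglongrightarrow> l"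
  shows "(g \<longlongrightarrow> l) (inf at_top (principal T))"
proof (rule ccontr)
  assume "\<not> ?thesis"
  then obtain S where S: "open S" "l \<in> S" and "\<not> (\<forall>\<^sub>F t in inf at_top (principal T). g t \<in> S)"
    by (auto simp: tendsto_def)
  then have "\<forall>n::nat. \<exists>t. t \<in> T \<and> real n \<le> t \<and> g t \<notin> S"
    by (auto simp: eventually_inf_principal eventually_at_top_linorder)
  from choice[OF this] obtain u where u: "\<And>n::nat. u n \<in> T" "\<And>n. real n \<le> u n" "\<And>n. g (u n) \<notin> S"
    by auto
  have "filterlim u at_top sequentially"
    by (rule filterlim_at_top_mono[OF filterlim_real_sequentially]) (use u in auto)
  then have "filterlim u (inf at_top (principal T)) sequentially"
    using u by (auto simp: filterlim_inf filterlim_principal)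
  from topological_tendstoD[OF assms[OF u(1) this] S] u(3) show False
    by (auto simp: eventually_sequentially)
qed

section \<open>From mean-square to L^p convergence\<close>

text \<open>A pointwise form of Chebyshev's inequality: the first term covers small
  \<open>z\<close>, and for the others \<open>z\<^sup>2 / \<delta>\<^sup>2\<close> is at least 1.
  Exponents below and above 2 are treated alike.\<close>

lemma powr_le_powr_plus_square:
  fixes z :: real
  assumes "\<bar>z\<bar> \<le> b" "0 < \<delta>" "0 \<le> p"
  shows "\<bar>z\<bar> powr p \<le> \<delta> powr p + b powr p / \<delta>\<^sup>2 * z\<^sup>2"
proof (cases "\<bar>z\<bar> \<le> \<delta>")
  case True
  have "\<bar>z\<bar> powr p \<le> \<delta> powr p" using True assms by (intro powr_mono2) auto
  moreover have "0 \<le> b powr p / \<delta>\<^sup>2 * z\<^sup>2" by simp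
  ultimately show ?thesis by linarith
next
  case False
  have "\<delta>\<^sup>2 \<le> \<bar>z\<bar>\<^sup>2" using False assms by (intro power_mono) auto
  then have "1 \<le> z\<^sup>2 / \<delta>\<^sup>2" using assms by simp
  have "\<bar>z\<bar> powr p \<le> b powr p" using assms by (intro powr_mono2) auto
  also have "\<dots> \<le> b powr p * (z\<^sup>2 / \<delta>\<^sup>2)"
    using \<open>1 \<le> z\<^sup>2 / \<delta>\<^sup>2\<close> mult_left_mono[of 1 "z\<^sup>2 / \<delta>\<^sup>2" "b powr p"] by simp
  finally show ?thesis by (simp add: add_increasing)
qed

text \<open>The bound of \<open>powr_le_powr_plus_square\<close> is integrated; its first term is
  made equal to \<open>e / 2\<close>, and the second is a fixed multiple of the second moment, hence
  eventually below \<open>e / 2\<close>.\<close>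

lemma bounded_Lp_converges:
  fixes X :: "real \<Rightarrow> 'w \<Rightarrow> real"
  assumes Q: "prob_space Q"
    and X: "\<And>t. t \<in> T \<Longrightarrow> X t \<in> borel_measurable Q"
    and b: "\<And>t \<omega>. t \<in> T \<Longrightarrow> \<omega> \<in> space Q \<Longrightarrow> \<bar>X t \<omega>\<bar> \<le> b"
    and L2: "((\<lambda>t. \<integral>\<omega>. (X t \<omega> - c)\<^sup>2 \<partial>Q) \<longlongrightarrow> 0) (inf at_top (principal T))"
    and p: "p \<ge> 1"
  shows "Lp_converges Q p T X (\<lambda>_. c)"
proof -
  interpret prob_space Q by fact
  have Lp: "(\<lambda>\<omega>. Y \<omega>) \<in> Lp_space Q p"
    if [measurable]: "Y \<in> borel_measurable Q" and "\<And>\<omega>. \<omega> \<in> space Q \<Longrightarrow> \<bar>Y \<omega>\<bar> \<le> b'" for Y b'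
    unfolding Lp_space_def using that p
    by (auto intro!: integrable_const_bound[where B="b' powr p"] AE_I2 powr_mono2)
  \<comment> \<open>The added 1 makes \<open>k\<close>, and with it the divisor \<open>a\<close>
    below, positive.\<close>
  define k where "k = \<bar>b\<bar> + \<bar>c\<bar> + 1"
  have k: "\<bar>X t \<omega> - c\<bar> \<le> k" if "t \<in> T" "\<omega> \<in> space Q" for t \<omega>
    using b[OF that] by (simp add: k_def)
  have "k > 0" by (simp add: k_def)
  have "((\<lambda>t. \<integral>\<omega>. \<bar>X t \<omega> - c\<bar> powr p \<partial>Q) \<longlongrightarrow> 0) (inf at_top (principal T))"
  proof (rule tendstoI)
    fix e :: real assume "e > 0"
    define \<delta> where "\<delta> = (e / 2) powr (1 / p)"
    have \<delta>: "\<delta> > 0" "\<delta> powr p = e / 2" using \<open>e > 0\<close> p by (auto simp: \<delta>_def powr_powr)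
    define a where "a = k powr p / \<delta>\<^sup>2"
    have "a > 0" using \<open>k > 0\<close> \<delta> by (simp add: a_def)
    have "\<forall>\<^sub>F t in inf at_top (principal T). dist (\<integral>\<omega>. (X t \<omega> - c)\<^sup>2 \<partial>Q) 0 < e / (2 * a)"
      using \<open>e > 0\<close> \<open>a > 0\<close> by (intro tendstoD[OF L2]) auto
    then have "\<forall>\<^sub>F t in inf at_top (principal T). t \<in> T \<and> (\<integral>\<omega>. (X t \<omega> - c)\<^sup>2 \<partial>Q) < e / (2 * a)"
      by (auto simp: eventually_inf_principal elim: eventually_mono)
    then show "\<forall>\<^sub>F t in inf at_top (principal T). dist (\<integral>\<omega>. \<bar>X t \<omega> - c\<bar> powr p \<partial>Q) 0 < e"
    proof eventually_elim
      fix t assume t: "t \<in> T \<and> (\<integral>\<omega>. (X t \<omega> - c)\<^sup>2 \<partial>Q) < e / (2 * a)"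
      then have [measurable]: "X t \<in> borel_measurable Q" using X by blast
      have i2: "integrable Q (\<lambda>\<omega>. (X t \<omega> - c)\<^sup>2)"
        by (rule integrable_const_bound[where B="k\<^sup>2"])
          (use k t \<open>k > 0\<close> in \<open>auto intro!: AE_I2 abs_le_square_iff[THEN iffD1]\<close>)
      have ip: "integrable Q (\<lambda>\<omega>. \<bar>X t \<omega> - c\<bar> powr p)"
        by (rule integrable_const_bound[where B="k powr p"]) (use k t p in \<open>auto intro!: AE_I2 powr_mono2\<close>)
      have "(\<integral>\<omega>. \<bar>X t \<omega> - c\<bar> powr p \<partial>Q) \<le> (\<integral>\<omega>. \<delta> powr p + a * (X t \<omega> - c)\<^sup>2 \<partial>Q)"
        unfolding a_def using k t p \<delta>
        by (intro integral_mono ip Bochner_Integration.integrable_add integrable_const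
            integrable_mult_right i2 powr_le_powr_plus_square) auto
      also have "\<dots> = e / 2 + a * (\<integral>\<omega>. (X t \<omega> - c)\<^sup>2 \<partial>Q)"
        using i2 by (simp add: \<delta> prob_space)
      also have "\<dots> < e"
        using t \<open>a > 0\<close> by (simp add: field_simps)
      finally show "dist (\<integral>\<omega>. \<bar>X t \<omega> - c\<bar> powr p \<partial>Q) 0 < e"
        by (simp add: dist_real_def)
    qed
  qed
  then have "((\<lambda>t. (\<integral>\<omega>. \<bar>X t \<omega> - c\<bar> powr p \<partial>Q) powr (1 / p)) \<longlongrightarrow> 0) (inf at_top (principal T))"
    using p by (intro tendsto_zero_powrI[OF _ tendsto_const]) auto
  then show ?thesis
    unfolding Lp_converges_def Lp_norm_def using Lp[OF X b] Lp[of "\<lambda>_. c" "\<bar>c\<bar>"] by auto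
qed

section \<open>Markov processes\<close>

context markov_process begin

section \<open>Time set, kernel and transition laws\<close>

lemma T_cases:
  obtains (discrete) "T = \<nat>" "\<tau> = count_space \<nat>"
  | (continuous) "T = {0..}" "\<tau> = restrict_space lborel {0..}"
  using time by blast

lemma T_nonneg: "t \<in> T \<Longrightarrow> 0 \<le> t"
  by (cases rule: T_cases) (auto simp: Nats_altdef2)

lemma T_add: "s \<in> T \<Longrightarrow> t \<in> T \<Longrightarrow> s + t \<in> T"
  by (cases rule: T_cases) auto

lemma T_diff: "s \<in> T \<Longrightarrow> t \<in> T \<Longrightarrow> s \<le> t \<Longrightarrow> t - s \<in> T"
  by (cases rule: T_cases) auto

lemma sets_P [simp, measurable_cong]: "sets (P x) = sets F"
  by (rule sets_prob)

lemma space_P [simp]: "space (P x) = space F"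
  by (rule sets_eq_imp_space_eq) simp

lemma measurable_M [measurable]: "t \<in> T \<Longrightarrow> M t \<in> F \<rightarrow>\<^sub>M borel"
  by (rule measurable_from_subalg[OF filtration_sub adapted])

text \<open>The kernel assumption recast as measurability into the Giry space, the form that
  mixtures and transition laws require.\<close>

lemma measurable_P [measurable]: "P \<in> borel \<rightarrow>\<^sub>M prob_algebra F"
proof (rule measurable_prob_algebraI)
  show "P \<in> borel \<rightarrow>\<^sub>M subprob_algebra F"
  proof (rule measurable_subprob_algebra)
    fix B assume B: "B \<in> sets F"
    have "(\<lambda>x. emeasure (P x) B) = (\<lambda>x. ennreal (measure (P x) B))"
      by (intro ext finite_measure.emeasure_eq_measure prob_space.axioms(1) prob)
    then show "(\<lambda>x. emeasure (P x) B) \<in> borel_measurable borel" using kernel[OF B] by simp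
  qed (auto intro: prob prob_space_imp_subprob_space)
qed (rule prob)

lemma prob_space_transition: "t \<in> T \<Longrightarrow> prob_space (transition P M t y)"
  unfolding transition_def by (intro prob_space.prob_space_distr prob) measurable

lemma transition_in_prob_algebra: "t \<in> T \<Longrightarrow> transition P M t y \<in> space (prob_algebra borel)"
  using prob_space_transition by (simp add: space_prob_algebra) (simp add: transition_def)

lemma measurable_transition [measurable]:
  assumes [measurable]: "t \<in> T"
  shows "transition P M t \<in> borel \<rightarrow>\<^sub>M subprob_algebra borel"
  unfolding transition_def
  by (rule measurable_compose[OF measurable_prob_algebraD[OF measurable_P] measurable_distr]) measurable

section \<open>The Markov property for integrals\<close>

text \<open>The factor \<open>\<phi> (M r)\<close> is measurable for \<open>Ft r\<close>, so the
  indicator may be replaced by its conditional expectation and then by the transition probability.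
  Boundedness of \<phi> makes the integrals finite and thus allows the passage from reals to
  \<open>ennreal\<close>, where measures are compared.\<close>

lemma markov_emeasure:
  assumes [measurable]: "r \<in> T" "u \<in> T" "A \<in> sets borel" "\<phi> \<in> borel_measurable borel"
    and \<phi>: "\<And>y. 0 \<le> \<phi> y" "\<And>y. \<phi> y \<le> c"
  shows "(\<integral>\<^sup>+\<omega>. ennreal (\<phi> (M r \<omega>)) * indicator {\<omega> \<in> space F. M (r + u) \<omega> \<in> A} \<omega> \<partial>P x) =
    (\<integral>\<^sup>+\<omega>. ennreal (\<phi> (M r \<omega>)) * emeasure (transition P M u (M r \<omega>)) A \<partial>P x)"
proof -
  interpret prob_space "P x" by (rule prob)
  let ?E = "{\<omega> \<in> space F. M (r + u) \<omega> \<in> A}"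
  have [measurable]: "r + u \<in> T" by (rule T_add) fact+
  have subalg: "subalgebra (P x) (Ft r)"
    using filtration_sub[OF \<open>r \<in> T\<close>] by (simp add: subalgebra_def)
  interpret finite_measure_subalgebra "P x" "Ft r"
    by (unfold_locales) (rule subalg)
  have [measurable]: "M r \<in> Ft r \<rightarrow>\<^sub>M borel" by (rule adapted) fact
  have [measurable]: "?E \<in> sets F" by measurable
  have tr: "measure (transition P M u y) A \<le> 1" for y
    by (rule prob_space.prob_le_1[OF prob_space_transition]) fact
  have em: "emeasure (transition P M u y) A = ennreal (measure (transition P M u y) A)" for y
    by (intro finite_measure.emeasure_eq_measure prob_space.axioms(1) prob_space_transition) fact
  have [measurable]: "(\<lambda>y. measure (transition P M u y) A) \<in> borel_measurable borel"
    using measurable_compose[OF measurable_transition measurable_measure_subprob_algebra] by simp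
  have "0 \<le> c" using \<phi>(1)[of undefined] \<phi>(2)[of undefined] by linarith
  have i1: "integrable (P x) (\<lambda>\<omega>. \<phi> (M r \<omega>) * indicator ?E \<omega>)"
    by (rule integrable_const_bound[where B=c]) (use \<phi> \<open>0 \<le> c\<close> in \<open>auto simp: indicator_def\<close>)
  have i2: "integrable (P x) (\<lambda>\<omega>. \<phi> (M r \<omega>) * measure (transition P M u (M r \<omega>)) A)"
    by (rule integrable_const_bound[where B="c * 1"])
      (use \<phi> \<open>0 \<le> c\<close> tr in \<open>auto simp: abs_mult intro!: mult_mono simp del: mult_1_right\<close>)
  have "(\<integral>\<^sup>+\<omega>. ennreal (\<phi> (M r \<omega>)) * indicator ?E \<omega> \<partial>P x) = (\<integral>\<^sup>+\<omega>. ennreal (\<phi> (M r \<omega>) * indicator ?E \<omega>) \<partial>P x)"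
    by (intro nn_integral_cong) (auto simp: indicator_def)
  also have "\<dots> = ennreal (\<integral>\<omega>. \<phi> (M r \<omega>) * indicator ?E \<omega> \<partial>P x)"
    by (rule nn_integral_eq_integral[OF i1]) (use \<phi> in auto)
  also have "(\<integral>\<omega>. \<phi> (M r \<omega>) * indicator ?E \<omega> \<partial>P x) =
      (\<integral>\<omega>. \<phi> (M r \<omega>) * real_cond_exp (P x) (Ft r) (indicator ?E) \<omega> \<partial>P x)"
    by (rule real_cond_exp_intg(2)[symmetric, OF i1]) measurable
  also have "\<dots> = (\<integral>\<omega>. \<phi> (M r \<omega>) * measure (transition P M u (M r \<omega>)) A \<partial>P x)"
  proof (rule integral_cong_AE)
    show "AE \<omega> in P x. \<phi> (M r \<omega>) * real_cond_exp (P x) (Ft r) (indicator ?E) \<omega> =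
        \<phi> (M r \<omega>) * measure (transition P M u (M r \<omega>)) A"
      using markov[OF \<open>u \<in> T\<close> \<open>r \<in> T\<close> \<open>A \<in> sets borel\<close>, of x] by eventually_elim simp
  qed measurable
  also have "ennreal \<dots> = (\<integral>\<^sup>+\<omega>. ennreal (\<phi> (M r \<omega>) * measure (transition P M u (M r \<omega>)) A) \<partial>P x)"
    by (rule nn_integral_eq_integral[OF i2, symmetric]) (use \<phi> in auto)
  also have "\<dots> = (\<integral>\<^sup>+\<omega>. ennreal (\<phi> (M r \<omega>)) * emeasure (transition P M u (M r \<omega>)) A \<partial>P x)"
    using \<phi> by (intro nn_integral_cong) (simp add: em ennreal_mult)
  finally show ?thesis .
qed

text \<open>
  Both sides are integrals of \<open>h\<close> against the same measure: the law of \<open>M (r + u)\<close> under the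
  measure with density \<open>\<phi> (M r)\<close>, once as an image and once as a mixture of transition laws.
\<close>
lemma markov_integral:
  fixes h \<phi> :: "'s \<Rightarrow> real"
  assumes T [measurable]: "r \<in> T" "u \<in> T"
    and [measurable]: "\<phi> \<in> borel_measurable borel" "h \<in> borel_measurable borel"
    and \<phi>: "\<And>y. 0 \<le> \<phi> y" "\<And>y. \<phi> y \<le> c" and h: "\<And>y. \<bar>h y\<bar> \<le> b"
  shows "(\<integral>\<omega>. \<phi> (M r \<omega>) * h (M (r + u) \<omega>) \<partial>P x) =
    (\<integral>\<omega>. \<phi> (M r \<omega>) * (\<integral>z. h z \<partial>transition P M u (M r \<omega>)) \<partial>P x)"
proof -
  interpret prob_space "P x" by (rule prob)
  have [measurable]: "r + u \<in> T" by (rule T_add) fact+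
  define D where "D = density (P x) (\<lambda>\<omega>. ennreal (\<phi> (M r \<omega>)))"
  have sets_D [simp, measurable_cong]: "sets D = sets F" by (simp add: D_def)
  have space_D: "space D = space F" by (simp add: D_def)
  have ne: "space D \<noteq> {}" using not_empty space_D by simp
  have K [measurable]: "(\<lambda>\<omega>. transition P M u (M r \<omega>)) \<in> F \<rightarrow>\<^sub>M subprob_algebra borel"
    by measurable
  have K_D: "(\<lambda>\<omega>. transition P M u (M r \<omega>)) \<in> D \<rightarrow>\<^sub>M subprob_algebra borel"
    using K by (simp cong: measurable_cong_sets)
  \<comment> \<open>Boundedness of \<phi> enters here: the integral over a mixture, used below, is
    taken with respect to a finite measure.\<close>
  have fin: "finite_measure D"
  proof (rule finite_measureI)
    have "emeasure D (space D) = (\<integral>\<^sup>+\<omega>. ennreal (\<phi> (M r \<omega>)) \<partial>P x)"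
      unfolding D_def by (subst emeasure_density) (auto intro!: nn_integral_cong)
    also have "\<dots> \<le> (\<integral>\<^sup>+\<omega>. ennreal c \<partial>P x)"
      using \<phi> by (intro nn_integral_mono ennreal_leI)
    finally show "emeasure D (space D) \<noteq> \<infinity>" by (auto simp: emeasure_space_1[simplified] top_unique)
  qed
  have eq: "distr D borel (M (r + u)) = D \<bind> (\<lambda>\<omega>. transition P M u (M r \<omega>))"
  proof (rule measure_eqI)
    fix A assume "A \<in> sets (distr D borel (M (r + u)))"
    then have A [measurable]: "A \<in> sets borel" by simp
    have "emeasure (distr D borel (M (r + u))) A =
        (\<integral>\<^sup>+\<omega>. ennreal (\<phi> (M r \<omega>)) * indicator {\<omega> \<in> space F. M (r + u) \<omega> \<in> A} \<omega> \<partial>P x)"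
      unfolding D_def by (subst emeasure_distr, measurable, subst emeasure_density)
        (auto intro!: nn_integral_cong simp: indicator_def)
    also have "\<dots> = (\<integral>\<^sup>+\<omega>. ennreal (\<phi> (M r \<omega>)) * emeasure (transition P M u (M r \<omega>)) A \<partial>P x)"
      by (rule markov_emeasure) (use \<phi> T in auto)
    also have "\<dots> = (\<integral>\<^sup>+\<omega>. emeasure (transition P M u (M r \<omega>)) A \<partial>D)"
      unfolding D_def by (subst nn_integral_density) auto
    also have "\<dots> = emeasure (D \<bind> (\<lambda>\<omega>. transition P M u (M r \<omega>))) A"
      by (rule emeasure_bind[symmetric, OF ne K_D A])
    finally show "emeasure (distr D borel (M (r + u))) A = emeasure (D \<bind> (\<lambda>\<omega>. transition P M u (M r \<omega>))) A" .
  qed (use ne in \<open>simp add: transition_def\<close>)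
  have "(\<integral>\<omega>. \<phi> (M r \<omega>) * h (M (r + u) \<omega>) \<partial>P x) = (\<integral>\<omega>. h (M (r + u) \<omega>) \<partial>D)"
    unfolding D_def by (subst integral_density) (use \<phi> in auto)
  also have "\<dots> = (\<integral>z. h z \<partial>distr D borel (M (r + u)))"
    by (subst integral_distr) auto
  also have "\<dots> = (\<integral>\<omega>. (\<integral>z. h z \<partial>transition P M u (M r \<omega>)) \<partial>D)"
    unfolding eq
    by (rule integral_bind[where K=borel and B=b and B'=1])
      (use h K_D fin prob_space_transition[OF T(2)] in \<open>auto simp: prob_space.emeasure_space_1\<close>)
  also have "\<dots> = (\<integral>\<omega>. \<phi> (M r \<omega>) * (\<integral>z. h z \<partial>transition P M u (M r \<omega>)) \<partial>P x)"
    unfolding D_def by (subst integral_density) (use \<phi> in auto)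
  finally show ?thesis .
qed

text \<open>Conditioning at time \<open>r\<close> replaces \<open>h (M (r + u))\<close> by its mean
  under the transition law, after which \<phi> is estimated by \<open>c\<close>. The remaining
  expectation is the quantity that the Wasserstein hypothesis controls.\<close>

lemma markov_integral_bound:
  fixes h \<phi> :: "'s \<Rightarrow> real"
  assumes T [measurable]: "r \<in> T" "u \<in> T"
    and [measurable]: "\<phi> \<in> borel_measurable borel" "h \<in> borel_measurable borel"
    and \<phi>: "\<And>y. 0 \<le> \<phi> y" "\<And>y. \<phi> y \<le> c" and h: "\<And>y. \<bar>h y\<bar> \<le> b"
  shows "\<bar>\<integral>\<omega>. \<phi> (M r \<omega>) * h (M (r + u) \<omega>) \<partial>P x\<bar> \<le>
    c * (\<integral>\<omega>. \<bar>\<integral>z. h z \<partial>transition P M u (M r \<omega>)\<bar> \<partial>P x)"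
proof -
  interpret prob_space "P x" by (rule prob)
  have hb: "\<bar>\<integral>z. h z \<partial>transition P M u y\<bar> \<le> b" for y
  proof -
    interpret tr: prob_space "transition P M u y" by (rule prob_space_transition) fact
    have "integrable (transition P M u y) h"
      by (rule tr.integrable_const_bound[where B=b]) (use h in \<open>auto simp: transition_def\<close>)
    then show ?thesis
      by (intro order_trans[OF integral_abs_bound] tr.integral_le_const) (use h in auto)
  qed
  have [measurable]: "(\<lambda>y. \<integral>z. h z \<partial>transition P M u y) \<in> borel_measurable borel"
    by measurable
  have "\<bar>\<integral>\<omega>. \<phi> (M r \<omega>) * (\<integral>z. h z \<partial>transition P M u (M r \<omega>)) \<partial>P x\<bar> \<le>
      (\<integral>\<omega>. c * \<bar>\<integral>z. h z \<partial>transition P M u (M r \<omega>)\<bar> \<partial>P x)"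
  proof (intro order_trans[OF integral_abs_bound] integral_mono)
    have "c \<ge> 0" using \<phi>(1)[of undefined] \<phi>(2)[of undefined] by linarith
    then show "integrable (P x) (\<lambda>\<omega>. c * \<bar>\<integral>z. h z \<partial>transition P M u (M r \<omega>)\<bar>)"
      by (intro integrable_const_bound[where B="c * b"])
        (use hb in \<open>auto simp: abs_mult intro!: mult_left_mono\<close>)
    show "integrable (P x) (\<lambda>\<omega>. \<bar>\<phi> (M r \<omega>) * (\<integral>z. h z \<partial>transition P M u (M r \<omega>))\<bar>)"
      by (intro integrable_const_bound[where B="c * b"])
        (use hb \<phi> \<open>c \<ge> 0\<close> in \<open>auto simp: abs_mult intro!: mult_mono\<close>)
  qed (use \<phi> in \<open>auto simp: abs_mult intro!: mult_right_mono\<close>)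
  then show ?thesis
    by (simp add: markov_integral[OF assms])
qed

section \<open>Time windows\<close>

text \<open>Makes the time integral one against a finite measure, so that discrete and continuous
  time share the later arguments.\<close>

abbreviation window :: "real \<Rightarrow> real measure" where
  "window t \<equiv> restrict_space \<tau> {0..<t}"

lemma window_cases:
  assumes "t \<in> T"
  obtains (discrete) n where "T = \<nat>" "t = real n" "window t = count_space (real ` {..<n})"
  | (continuous) "T = {0..}" "t \<ge> 0" "window t = restrict_space lborel {0..<t}"
proof (cases rule: T_cases)
  case discrete
  then obtain n where n: "t = real n" using assms by (auto elim: Nats_cases)
  then have "window t = count_space (real ` {..<n})"
    using discrete by (simp add: restrict_count_space Int_commute flip: Nats_Int_lessThan)
  with discrete n that(1) show ?thesis by blast
next
  case continuous
  have "{0::real..} \<inter> {0..<t} = {0..<t}" by auto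
  then have "window t = restrict_space lborel {0..<t}"
    using continuous by (simp add: restrict_restrict_space)
  with continuous assms that(2) show ?thesis by auto
qed

lemma set_lebesgue_integral_window:
  fixes h :: "real \<Rightarrow> real"
  shows "(LINT s:{0..<t}|\<tau>. h s) = (\<integral>s. h s \<partial>window t)"
proof -
  have "{0..<t} \<inter> space \<tau> \<in> sets \<tau>"
    by (cases rule: T_cases) (auto simp: space_restrict_space sets_restrict_space)
  then show ?thesis
    by (simp add: set_lebesgue_integral_def integral_restrict_space)
qed

lemma space_window: "t \<in> T \<Longrightarrow> space (window t) = T \<inter> {0..<t}"
  by (erule window_cases) (auto simp: space_restrict_space simp flip: Nats_Int_lessThan)

text \<open>The half-open interval matters: it contains exactly \<open>n\<close> naturals when
  \<open>t = real n\<close>, so the mass is \<open>t\<close> for both time sets.\<close>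

lemma measure_window: "t \<in> T \<Longrightarrow> measure (window t) (space (window t)) = t"
  by (erule window_cases) (auto simp: measure_restrict_space space_restrict_space card_image)

lemma finite_measure_window: "t \<in> T \<Longrightarrow> finite_measure (window t)"
  by (erule window_cases)
    (auto intro!: finite_measureI simp: emeasure_restrict_space space_restrict_space)

text \<open>Provides the sets \<open>D s\<close> of \<open>second_moment_le\<close>. The bound
  covers both the count of at most \<open>2 * U + 1\<close> naturals and the length
  \<open>2 * U\<close>; it is independent of \<open>t\<close> and so negligible against
  \<open>t\<close>.\<close>

lemma window_near:
  assumes "t \<in> T" "U \<ge> 0"
  shows "{r \<in> space (window t). \<bar>r - s\<bar> < U} \<in> sets (window t)"
    and "measure (window t) {r \<in> space (window t). \<bar>r - s\<bar> < U} \<le> 2 * U + 1"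
proof -
  let ?D = "{r \<in> space (window t). \<bar>r - s\<bar> < U}"
  have "?D \<in> sets (window t) \<and> measure (window t) ?D \<le> 2 * U + 1"
    using assms(1)
  proof (cases rule: window_cases)
    case (discrete n)
    have "?D \<subseteq> \<nat> \<inter> {s - U..s + U}"
      using discrete by (auto simp: abs_less_iff)
    then have "card ?D \<le> card (\<nat> \<inter> {s - U..s + U})"
      by (intro card_mono card_Nats_interval_le(2) \<open>U \<ge> 0\<close>)
    moreover have "measure (window t) ?D = card ?D"
      by (auto simp: discrete(3) measure_count_space)
    ultimately show ?thesis
      using card_Nats_interval_le(1)[OF \<open>U \<ge> 0\<close>, of s] discrete by auto
  next
    case continuous
    have D: "?D = {0..<t} \<inter> {s - U<..<s + U}"
      unfolding continuous by (auto simp: space_restrict_space)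
    have "measure (window t) ?D = measure lborel ?D"
      unfolding continuous by (rule measure_restrict_space) (auto simp: space_restrict_space)
    also have "\<dots> \<le> measure lborel {s - U..s + U}"
      unfolding D by (intro measure_mono_fmeasurable) (auto simp: fmeasurable_def emeasure_lborel_Icc_eq)
    finally have "measure (window t) ?D \<le> 2 * U + 1" using \<open>U \<ge> 0\<close> by simp
    moreover have "?D \<in> sets (window t)"
      unfolding D by (subst continuous) (auto simp: sets_restrict_space intro!: image_eqI[of _ _ "{s - U<..<s + U}"])
    ultimately show ?thesis by blast
  qed
  then show "?D \<in> sets (window t)" "measure (window t) ?D \<le> 2 * U + 1" by auto
qed

text \<open>Joint measurability is what Fubini over time and \<Omega> needs. In discrete time the
  first factor is countable; in continuous time it follows from progressive measurability up to
  \<open>t\<close>.\<close>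

lemma measurable_M_window:
  assumes "t \<in> T"
  shows "(\<lambda>(s, \<omega>). M s \<omega>) \<in> window t \<Otimes>\<^sub>M F \<rightarrow>\<^sub>M borel"
  using assms
proof (cases rule: window_cases)
  case (discrete n)
  show ?thesis unfolding discrete(3)
    by (rule measurable_pair_measure_countable1) (use discrete in \<open>auto intro!: measurable_M\<close>)
next
  case continuous
  have "fst \<in> window t \<Otimes>\<^sub>M F \<rightarrow>\<^sub>M restrict_space borel {0..t}"
  proof (rule measurable_restrict_space2)
    show "fst \<in> space (window t \<Otimes>\<^sub>M F) \<rightarrow> {0..t}"
      by (auto simp: space_pair_measure continuous space_restrict_space)
    show "fst \<in> window t \<Otimes>\<^sub>M F \<rightarrow>\<^sub>M borel"
      by (rule measurable_compose[OF measurable_fst]) (simp add: continuous measurable_restrict_space1)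
  qed
  moreover have "snd \<in> window t \<Otimes>\<^sub>M F \<rightarrow>\<^sub>M Ft t"
    using measurable_compose[OF measurable_snd measurable_from_subalg[OF filtration_sub[OF assms] measurable_ident]]
    by simp
  ultimately have "(\<lambda>z. (fst z, snd z)) \<in> window t \<Otimes>\<^sub>M F \<rightarrow>\<^sub>M restrict_space borel {0..t} \<Otimes>\<^sub>M Ft t"
    by (rule measurable_Pair)
  from measurable_compose[OF this progressive[OF continuous(1) assms]] show ?thesis
    by (simp add: split_beta')
qed

section \<open>Decay of correlations\<close>

text \<open>Conditioning at the earlier time leaves the mean of the difference between the
  \<pi>-mean of \<open>f\<close> and its mean under the law after the lag \<open>u\<close>; this is
  bounded through \<open>d_W\<close>. The supremum over starting times in the hypothesis makes one
  \<open>U\<close> valid for every \<open>r\<close>, though it may depend on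
  \<open>x\<close>.\<close>

lemma correlations_vanish:
  assumes dist1: "\<forall>x y :: 's. dist x y \<le> 1"
    and pi: "\<pi> \<in> space (prob_algebra borel)"
    and ergodic: "((\<lambda>t. SUP s\<in>T. \<integral>\<^sup>+ y. ennreal (d_W (transition P M t y) \<pi>) \<partial>transition P M s x)
      \<longlongrightarrow> 0) (inf at_top (principal T))"
    and f: "f \<in> C_bu" and "e > 0"
  obtains U where "U \<ge> 0"
    "\<And>r u. r \<in> T \<Longrightarrow> u \<in> T \<Longrightarrow> u \<ge> U \<Longrightarrow>
      \<bar>\<integral>\<omega>. (f (M r \<omega>) - (\<integral>y. f y \<partial>\<pi>)) * (f (M (r + u) \<omega>) - (\<integral>y. f y \<partial>\<pi>)) \<partial>P x\<bar> \<le> e"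
proof -
  interpret prob_space "P x" by (rule prob)
  obtain B where B: "\<And>y. \<bar>f y\<bar> \<le> B"
    using f by (auto simp: C_bu_def bounded_iff)
  have "B \<ge> 0" using B[of undefined] by linarith
  have [measurable]: "f \<in> borel_measurable borel"
    using f by (auto simp: C_bu_def intro!: borel_measurable_continuous_onI uniformly_continuous_imp_continuous)
  define c where "c = (\<integral>y. f y \<partial>\<pi>)"
  define g where "g y = f y - c" for y
  have [measurable]: "g \<in> borel_measurable borel" unfolding g_def by measurable
  have g: "\<bar>g y\<bar> \<le> B + \<bar>c\<bar>" for y using B[of y] unfolding g_def by linarith
  define b where "b = B + \<bar>c\<bar> + 1"
  have b: "b > 0" "\<And>y. \<bar>g y\<bar> \<le> b" using \<open>B \<ge> 0\<close> by (auto simp: b_def intro: order_trans[OF g])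
  \<comment> \<open>The final estimate is \<open>3 * (b * (2 * e'))\<close>: the shifted factor
    \<open>g + b\<close> costs \<open>2 * b\<close>, the constant \<open>b\<close> costs
    \<open>b\<close>, and the conditional mean is at most \<open>2 * e'\<close>.\<close>
  define e' where "e' = e / (6 * b)"
  have "e' > 0" using \<open>e > 0\<close> b by (simp add: e'_def)
  obtain L where L: "L > 0" and f_W: "\<And>\<mu> \<nu>. \<mu> \<in> space (prob_algebra borel) \<Longrightarrow> \<nu> \<in> space (prob_algebra borel) \<Longrightarrow>
      \<bar>(\<integral>y. f y \<partial>\<mu>) - (\<integral>y. f y \<partial>\<nu>)\<bar> \<le> L * d_W \<mu> \<nu> + e'"
    using C_bu_d_W[OF dist1 f \<open>e' > 0\<close>] by blast
  \<comment> \<open>After multiplication by \<open>L\<close> this threshold yields one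
    \<open>e'\<close>; the Lipschitz approximation error is the other.\<close>
  have "0 < ennreal (e' / L)" using L \<open>e' > 0\<close> by simp
  from order_tendstoD(2)[OF ergodic this] obtain U0 where
    U0: "\<And>u. u \<in> T \<Longrightarrow> u \<ge> U0 \<Longrightarrow>
      (SUP s\<in>T. \<integral>\<^sup>+ y. ennreal (d_W (transition P M u y) \<pi>) \<partial>transition P M s x) < ennreal (e' / L)"
    by (auto simp: eventually_inf_principal eventually_at_top_linorder)
  have mean: "(\<integral>\<omega>. \<bar>\<integral>z. g z \<partial>transition P M u (M r \<omega>)\<bar> \<partial>P x) \<le> 2 * e'"
    if T [measurable]: "r \<in> T" "u \<in> T" and u: "u \<ge> U0" for r u
  proof -
    define G where "G y = \<bar>\<integral>z. g z \<partial>transition P M u y\<bar>" for y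
    have [measurable]: "G \<in> borel_measurable borel" unfolding G_def by measurable
    \<comment> \<open>\<open>d_W\<close> need not be measurable in \<open>y\<close>, so its nonnegative integral is only used as an upper
      bound for that of the measurable minorant \<open>k\<close>, not split or scaled.\<close>
    define k where "k y = max 0 ((G y - e') / L)" for y
    have [measurable]: "k \<in> borel_measurable borel" unfolding k_def by measurable
    have G_le: "G y \<le> L * d_W (transition P M u y) \<pi> + e'" "G y \<le> b" for y
    proof -
      interpret tr: prob_space "transition P M u y" by (rule prob_space_transition) fact
      have "integrable (transition P M u y) f"
        by (rule tr.integrable_const_bound[where B=B]) (use B in \<open>auto simp: transition_def\<close>)
      then have "(\<integral>z. g z \<partial>transition P M u y) = (\<integral>z. f z \<partial>transition P M u y) - c"
        by (simp add: g_def tr.prob_space)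
      then show "G y \<le> L * d_W (transition P M u y) \<pi> + e'"
        using f_W[OF transition_in_prob_algebra[OF T(2)] pi, of y] by (simp add: G_def c_def)
      have "integrable (transition P M u y) g"
        by (rule tr.integrable_const_bound[where B=b]) (use b in \<open>auto simp: transition_def\<close>)
      then show "G y \<le> b" unfolding G_def
        by (intro order_trans[OF integral_abs_bound] tr.integral_le_const) (use b in auto)
    qed
    have "(\<integral>\<^sup>+\<omega>. ennreal (k (M r \<omega>)) \<partial>P x) = (\<integral>\<^sup>+y. ennreal (k y) \<partial>transition P M r x)"
      unfolding transition_def by (subst nn_integral_distr) auto
    also have "\<dots> \<le> (\<integral>\<^sup>+y. ennreal (d_W (transition P M u y) \<pi>) \<partial>transition P M r x)"
    proof (rule nn_integral_mono)
      fix y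
      have "(G y - e') / L \<le> d_W (transition P M u y) \<pi>"
        using G_le(1)[of y] L by (simp add: field_simps)
      then have "ennreal ((G y - e') / L) \<le> ennreal (d_W (transition P M u y) \<pi>)"
        by (rule ennreal_leI)
      then show "ennreal (k y) \<le> ennreal (d_W (transition P M u y) \<pi>)"
        by (simp add: k_def max_def ennreal_neg)
    qed
    also have "\<dots> \<le> (SUP s\<in>T. \<integral>\<^sup>+ y. ennreal (d_W (transition P M u y) \<pi>) \<partial>transition P M s x)"
      using T by (intro SUP_upper)
    also have "\<dots> \<le> ennreal (e' / L)" using U0[OF T(2) u] by simp
    finally have le: "(\<integral>\<^sup>+\<omega>. ennreal (k (M r \<omega>)) \<partial>P x) \<le> ennreal (e' / L)" .
    have k0: "k y \<ge> 0" for y by (simp add: k_def)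
    have ik: "integrable (P x) (\<lambda>\<omega>. k (M r \<omega>))"
      using le k0 by (intro integrableI_bounded) (auto intro: le_less_trans)
    have "(\<integral>\<omega>. k (M r \<omega>) \<partial>P x) \<le> e' / L"
      using le nn_integral_eq_integral[OF ik] k0 L \<open>e' > 0\<close> by simp
    have "(\<integral>\<omega>. G (M r \<omega>) \<partial>P x) \<le> (\<integral>\<omega>. L * k (M r \<omega>) + e' \<partial>P x)"
    proof (intro integral_mono)
      show "integrable (P x) (\<lambda>\<omega>. G (M r \<omega>))"
        by (rule integrable_const_bound[where B=b]) (use G_le in \<open>auto simp: G_def\<close>)
      show "G (M r \<omega>) \<le> L * k (M r \<omega>) + e'" for \<omega>
        using L by (simp add: k_def max_def field_simps)
    qed (use ik in auto)
    also have "\<dots> = L * (\<integral>\<omega>. k (M r \<omega>) \<partial>P x) + e'"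
      using ik by (simp add: prob_space[simplified])
    also have "\<dots> \<le> 2 * e'"
      using \<open>(\<integral>\<omega>. k (M r \<omega>) \<partial>P x) \<le> e' / L\<close> L by (simp add: field_simps)
    finally show ?thesis unfolding G_def .
  qed
  show ?thesis
  proof (rule that[of "max U0 0"])
    fix r u assume T: "r \<in> T" "u \<in> T" and u: "u \<ge> max U0 0"
    note [measurable] = T T_add[OF T]
    let ?m = "\<integral>\<omega>. \<bar>\<integral>z. g z \<partial>transition P M u (M r \<omega>)\<bar> \<partial>P x"
    have m: "?m \<le> 2 * e'" using mean[OF T] u by simp
    have shift: "0 \<le> g y + b" "g y + b \<le> 2 * b" for y using b(2)[of y] by linarith+
    \<comment> \<open>The Markov bound needs a nonnegative first factor, whence \<open>g = (g + b) - b\<close>.\<close>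
    have "\<bar>\<integral>\<omega>. (g (M r \<omega>) + b) * g (M (r + u) \<omega>) \<partial>P x\<bar> \<le> 2 * b * ?m"
      by (rule markov_integral_bound[where \<phi>="\<lambda>y. g y + b", OF T])
        (use b shift in auto)
    moreover have "\<bar>\<integral>\<omega>. b * g (M (r + u) \<omega>) \<partial>P x\<bar> \<le> b * ?m"
      by (rule markov_integral_bound[where \<phi>="\<lambda>_. b", OF T]) (use b in auto)
    moreover have "(\<integral>\<omega>. (g (M r \<omega>) + b) * g (M (r + u) \<omega>) \<partial>P x) =
        (\<integral>\<omega>. g (M r \<omega>) * g (M (r + u) \<omega>) \<partial>P x) + (\<integral>\<omega>. b * g (M (r + u) \<omega>) \<partial>P x)"
      unfolding distrib_right
    proof (rule Bochner_Integration.integral_add)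
      show "integrable (P x) (\<lambda>\<omega>. g (M r \<omega>) * g (M (r + u) \<omega>))"
        by (rule integrable_const_bound[where B="b * b"])
          (use b in \<open>auto simp: abs_mult less_imp_le intro!: mult_mono\<close>)
      show "integrable (P x) (\<lambda>\<omega>. b * g (M (r + u) \<omega>))"
        by (rule integrable_const_bound[where B="b * b"])
          (use b in \<open>auto simp: abs_mult less_imp_le intro!: mult_mono\<close>)
    qed
    ultimately have "\<bar>\<integral>\<omega>. g (M r \<omega>) * g (M (r + u) \<omega>) \<partial>P x\<bar> \<le> 3 * (b * ?m)" by linarith
    also have "\<dots> \<le> 3 * (b * (2 * e'))" using b m by simp
    also have "\<dots> = e" using b by (simp add: e'_def)
    finally show "\<bar>\<integral>\<omega>. (f (M r \<omega>) - (\<integral>y. f y \<partial>\<pi>)) * (f (M (r + u) \<omega>) - (\<integral>y. f y \<partial>\<pi>)) \<partial>P x\<bar> \<le> e"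
      by (simp add: g_def c_def)
  qed simp
qed

section \<open>Time averages\<close>

definition time_average :: "('s \<Rightarrow> real) \<Rightarrow> real \<Rightarrow> 'w \<Rightarrow> real" where
  "time_average f t \<omega> = 1 / t * (LINT s:{0..<t}|\<tau>. f (M s \<omega>))"

lemma measurable_time_average [measurable]:
  assumes "t \<in> T" and f [measurable]: "f \<in> borel_measurable borel"
  shows "time_average f t \<in> borel_measurable F"
proof -
  interpret finite_measure "window t" by (rule finite_measure_window) fact
  note measurable_M_window[OF \<open>t \<in> T\<close>, measurable]
  have "(\<lambda>(\<omega>, s). f (M s \<omega>)) \<in> borel_measurable (F \<Otimes>\<^sub>M window t)"
    by measurable
  then show ?thesis
    unfolding time_average_def set_lebesgue_integral_window
    by (intro borel_measurable_times borel_measurable_const borel_measurable_lebesgue_integral)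
qed

lemma integrable_window:
  fixes f :: "'s \<Rightarrow> real"
  assumes t: "t \<in> T" and \<omega>: "\<omega> \<in> space F"
    and f [measurable]: "f \<in> borel_measurable borel" and b: "\<And>y. \<bar>f y\<bar> \<le> b"
  shows "integrable (window t) (\<lambda>s. f (M s \<omega>))"
proof -
  interpret finite_measure "window t" by (rule finite_measure_window) fact
  have "(\<lambda>s. f (M s \<omega>)) \<in> borel_measurable (window t)"
    using measurable_compose[OF measurable_Pair2'[OF \<omega>] measurable_M_window[OF t]] f by simp
  then show ?thesis
    by (intro integrable_const_bound[where B=b]) (use b in auto)
qed

text \<open>The time \<open>t = 0\<close> is included because \<open>Lp_converges\<close> demands
  integrability at every time of \<open>T\<close>; there \<open>1 / t\<close> is 0, so the average
  vanishes.\<close>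

lemma time_average_bounded:
  fixes f :: "'s \<Rightarrow> real"
  assumes t: "t \<in> T" and \<omega>: "\<omega> \<in> space F"
    and f: "f \<in> borel_measurable borel" and b: "\<And>y. \<bar>f y\<bar> \<le> b"
  shows "\<bar>time_average f t \<omega>\<bar> \<le> b"
proof -
  interpret finite_measure "window t" by (rule finite_measure_window) fact
  have "\<bar>\<integral>s. f (M s \<omega>) \<partial>window t\<bar> \<le> (\<integral>s. b \<partial>window t)"
    using integrable_window[OF assms] b
    by (intro order_trans[OF integral_abs_bound] integral_mono) auto
  also have "\<dots> = b * t" using measure_window[OF t] by simp
  finally have "\<bar>\<integral>s. f (M s \<omega>) \<partial>window t\<bar> \<le> b * t" .
  moreover have "b \<ge> 0" using b[of undefined] by linarith
  ultimately show ?thesis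
    using T_nonneg[OF t]
    by (cases "t = 0") (auto simp: time_average_def set_lebesgue_integral_window abs_mult field_simps)
qed

text \<open>\<open>second_moment_le\<close> on a window of mass \<open>t\<close> bounds the second
  moment of the integral of \<open>G\<close> by
  \<open>t * (e / 2 * t + b\<^sup>2 * (2 * U + 1))\<close>. Division by \<open>t\<^sup>2\<close>
  leaves \<open>e / 2\<close> and a term of order \<open>1 / t\<close>.\<close>

lemma time_average_mean_square:
  assumes dist1: "\<forall>x y :: 's. dist x y \<le> 1"
    and pi: "\<pi> \<in> space (prob_algebra borel)"
    and ergodic: "((\<lambda>t. SUP s\<in>T. \<integral>\<^sup>+ y. ennreal (d_W (transition P M t y) \<pi>) \<partial>transition P M s x)
      \<longlongrightarrow> 0) (inf at_top (principal T))"
    and f: "f \<in> C_bu"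
  shows "((\<lambda>t. \<integral>\<omega>. (time_average f t \<omega> - (\<integral>y. f y \<partial>\<pi>))\<^sup>2 \<partial>P x) \<longlongrightarrow> 0) (inf at_top (principal T))"
proof (rule tendstoI)
  fix e :: real assume "e > 0"
  obtain B where B: "\<And>y. \<bar>f y\<bar> \<le> B"
    using f by (auto simp: C_bu_def bounded_iff)
  have f_meas [measurable]: "f \<in> borel_measurable borel"
    using f by (auto simp: C_bu_def intro!: borel_measurable_continuous_onI uniformly_continuous_imp_continuous)
  define c where "c = (\<integral>y. f y \<partial>\<pi>)"
  define G where "G s \<omega> = f (M s \<omega>) - c" for s \<omega>
  define b where "b = B + \<bar>c\<bar>"
  have b: "\<bar>G s \<omega>\<bar> \<le> b" for s \<omega> using B[of "M s \<omega>"] unfolding G_def b_def by linarith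
  have "e / 2 > 0" using \<open>e > 0\<close> by simp
  from correlations_vanish[OF dist1 pi ergodic f this] obtain U where U: "U \<ge> 0"
    and corr: "\<And>r u. r \<in> T \<Longrightarrow> u \<in> T \<Longrightarrow> u \<ge> U \<Longrightarrow> \<bar>\<integral>\<omega>. G r \<omega> * G (r + u) \<omega> \<partial>P x\<bar> \<le> e / 2"
    unfolding G_def c_def by blast
  \<comment> \<open>Beyond \<open>t0\<close> the term of order \<open>1 / t\<close> is below
    \<open>e / 2\<close>; the maximum with 0 ensures \<open>t > 0\<close>.\<close>
  define t0 where "t0 = max 0 (2 * (b\<^sup>2 * (2 * U + 1)) / e)"
  have main: "(\<integral>\<omega>. (time_average f t \<omega> - c)\<^sup>2 \<partial>P x) < e" if t: "t \<in> T" and t0: "t > t0" for t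
  proof -
    have "t > 0" using t0 by (simp add: t0_def)
    interpret N: finite_measure "window t" by (rule finite_measure_window) fact
    note measurable_M_window[OF t, measurable]
    have "(\<integral>\<omega>. (\<integral>s. G s \<omega> \<partial>window t)\<^sup>2 \<partial>P x) \<le>
        measure (window t) (space (window t)) *
          (e / 2 * measure (window t) (space (window t)) + b\<^sup>2 * (2 * U + 1))"
    proof (rule second_moment_le[where D="\<lambda>s. {r \<in> space (window t). \<bar>r - s\<bar> < U}"])
      show "case_prod G \<in> borel_measurable (window t \<Otimes>\<^sub>M P x)"
        unfolding G_def by measurable
      fix s r
      assume s: "s \<in> space (window t)" and r: "r \<in> space (window t)"
        and "r \<notin> {r \<in> space (window t). \<bar>r - s\<bar> < U}"
      then have "\<bar>r - s\<bar> \<ge> U" by simp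
      moreover have T: "r \<in> T" "s \<in> T" using r s by (auto simp: space_window[OF t])
      \<comment> \<open>The correlation bound takes the earlier time first, so the pair is ordered;
        the lag lies in \<open>T\<close> by \<open>T_diff\<close>.\<close>
      ultimately consider "r \<le> s" "s - r \<ge> U" | "s \<le> r" "r - s \<ge> U" by fastforce
      then show "\<bar>\<integral>\<omega>. G r \<omega> * G s \<omega> \<partial>P x\<bar> \<le> e / 2"
      proof cases
        case 1
        then show ?thesis using corr[of r "s - r"] T T_diff by simp
      next
        case 2
        then show ?thesis using corr[of s "r - s"] T T_diff by (simp add: mult.commute)
      qed
    qed (use b \<open>e > 0\<close> U window_near[OF t U] finite_measure_window[OF t] prob in auto)
    then have sm: "(\<integral>\<omega>. (\<integral>s. G s \<omega> \<partial>window t)\<^sup>2 \<partial>P x) \<le> t * (e / 2 * t + b\<^sup>2 * (2 * U + 1))"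
      by (simp add: measure_window[OF t])
    have "(\<integral>\<omega>. (time_average f t \<omega> - c)\<^sup>2 \<partial>P x) = (\<integral>\<omega>. (1 / t)\<^sup>2 * (\<integral>s. G s \<omega> \<partial>window t)\<^sup>2 \<partial>P x)"
    proof (rule Bochner_Integration.integral_cong)
      fix \<omega> assume "\<omega> \<in> space (P x)"
      then have "integrable (window t) (\<lambda>s. f (M s \<omega>))"
        using integrable_window[OF t _ f_meas B] by simp
      then have "(\<integral>s. G s \<omega> \<partial>window t) = (\<integral>s. f (M s \<omega>) \<partial>window t) - c * t"
        unfolding G_def using measure_window[OF t] by simp
      then have "time_average f t \<omega> - c = 1 / t * (\<integral>s. G s \<omega> \<partial>window t)"
        using \<open>t > 0\<close> by (simp add: time_average_def set_lebesgue_integral_window field_simps)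
      then show "(time_average f t \<omega> - c)\<^sup>2 = (1 / t)\<^sup>2 * (\<integral>s. G s \<omega> \<partial>window t)\<^sup>2"
        by (simp only: power_mult_distrib)
    qed simp
    also have "\<dots> = (1 / t)\<^sup>2 * (\<integral>\<omega>. (\<integral>s. G s \<omega> \<partial>window t)\<^sup>2 \<partial>P x)" by simp
    also have "\<dots> \<le> (1 / t)\<^sup>2 * (t * (e / 2 * t + b\<^sup>2 * (2 * U + 1)))"
      using sm by (intro mult_left_mono) auto
    also have "\<dots> = e / 2 + b\<^sup>2 * (2 * U + 1) / t"
      using \<open>t > 0\<close> by (simp add: power2_eq_square field_simps)
    also have "b\<^sup>2 * (2 * U + 1) / t < e / 2"
    proof -
      have "2 * (b\<^sup>2 * (2 * U + 1)) / e < t" using t0 by (simp add: t0_def)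
      then have "2 * (b\<^sup>2 * (2 * U + 1)) < t * e" using \<open>e > 0\<close> by (simp only: pos_divide_less_eq)
      then show ?thesis using \<open>t > 0\<close> by (simp only: pos_divide_less_eq) (simp add: mult.commute)
    qed
    finally show ?thesis by simp
  qed
  have "\<forall>\<^sub>F t in at_top. t \<in> T \<longrightarrow> (\<integral>\<omega>. (time_average f t \<omega> - c)\<^sup>2 \<partial>P x) < e"
    using eventually_gt_at_top[of t0] by eventually_elim (use main in blast)
  then show "\<forall>\<^sub>F t in inf at_top (principal T). dist (\<integral>\<omega>. (time_average f t \<omega> - (\<integral>y. f y \<partial>\<pi>))\<^sup>2 \<partial>P x) 0 < e"
    by (simp add: eventually_inf_principal dist_real_def flip: c_def)
qed

text \<open>The speed of convergence may depend on the initial point, but the second moments have a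
  common constant bound, so dominated convergence with respect to \<mu> carries the limit over to
  the mixture.\<close>

lemma mean_ergodic_C_bu:
  assumes dist1: "\<forall>x y :: 's. dist x y \<le> 1"
    and pi: "\<pi> \<in> space (prob_algebra borel)"
    and ergodic: "\<forall>x. ((\<lambda>t. SUP s\<in>T. \<integral>\<^sup>+ y. ennreal (d_W (transition P M t y) \<pi>) \<partial>transition P M s x)
      \<longlongrightarrow> 0) (inf at_top (principal T))"
    and f: "f \<in> C_bu" and \<mu>: "\<mu> \<in> space (prob_algebra borel)"
  shows "mean_ergodic T \<tau> P M \<pi> f \<mu>"
proof -
  interpret \<mu>: prob_space \<mu> using \<mu> by (simp add: space_prob_algebra)
  have [measurable_cong]: "sets \<mu> = sets borel" using \<mu> by (simp add: space_prob_algebra)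
  obtain B where B: "\<And>y. \<bar>f y\<bar> \<le> B"
    using f by (auto simp: C_bu_def bounded_iff)
  have f_meas [measurable]: "f \<in> borel_measurable borel"
    using f by (auto simp: C_bu_def intro!: borel_measurable_continuous_onI uniformly_continuous_imp_continuous)
  have kernel [measurable]: "P \<in> \<mu> \<rightarrow>\<^sub>M subprob_algebra F"
    by (intro measurable_prob_algebraD) measurable
  have sets_bind [simp, measurable_cong]: "sets (\<mu> \<bind> P) = sets F"
    using \<mu>.not_empty by (intro sets_bind) auto
  have space_bind: "space (\<mu> \<bind> P) = space F" by (rule sets_eq_imp_space_eq) simp
  have prob_bind: "prob_space (\<mu> \<bind> P)"
    by (rule \<mu>.prob_space_bind[OF _ kernel]) (simp add: prob)
  define c where "c = (\<integral>y. f y \<partial>\<pi>)"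
  define b where "b = (B + \<bar>c\<bar>)\<^sup>2"
  have b: "(time_average f t \<omega> - c)\<^sup>2 \<le> b" if "t \<in> T" "\<omega> \<in> space F" for t \<omega>
    using time_average_bounded[OF that f_meas B] unfolding b_def
    by (intro abs_le_square_iff[THEN iffD1]) auto
  \<comment> \<open>Integration against the mixture is iterated: first under \<open>P x\<close>,
    then over \<open>x\<close>. Here \<open>B'\<close> bounds the total mass of each
    \<open>P x\<close>.\<close>
  have mixture: "(\<integral>\<omega>. (time_average f t \<omega> - c)\<^sup>2 \<partial>(\<mu> \<bind> P)) =
      (\<integral>x. (\<integral>\<omega>. (time_average f t \<omega> - c)\<^sup>2 \<partial>P x) \<partial>\<mu>)" if [measurable]: "t \<in> T" for t
    by (rule integral_bind[where K=F and B=b and B'=1])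
      (use b that kernel in \<open>auto simp: prob_space.emeasure_space_1[OF prob, simplified] \<mu>.finite_measure_axioms\<close>)
  have "((\<lambda>t. \<integral>\<omega>. (time_average f t \<omega> - c)\<^sup>2 \<partial>(\<mu> \<bind> P)) \<longlongrightarrow> 0) (inf at_top (principal T))"
  proof (rule tendsto_inf_at_top_principalI)
    fix u :: "nat \<Rightarrow> real"
    assume u [measurable]: "\<And>n. u n \<in> T" and lim: "filterlim u (inf at_top (principal T)) sequentially"
    have "(\<lambda>n. \<integral>x. (\<integral>\<omega>. (time_average f (u n) \<omega> - c)\<^sup>2 \<partial>P x) \<partial>\<mu>) \<longlonglongrightarrow> (\<integral>x. 0 \<partial>\<mu>)"
    proof (rule integral_dominated_convergence[where w="\<lambda>_. b"])
      show "AE x in \<mu>. (\<lambda>n. \<integral>\<omega>. (time_average f (u n) \<omega> - c)\<^sup>2 \<partial>P x) \<longlonglongrightarrow> 0"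
        using filterlim_compose[OF time_average_mean_square[OF dist1 pi _ f] lim] ergodic
        unfolding c_def by blast
      show "AE x in \<mu>. norm (\<integral>\<omega>. (time_average f (u n) \<omega> - c)\<^sup>2 \<partial>P x) \<le> b" for n
      proof (rule AE_I2)
        fix x
        interpret prob_space "P x" by (rule prob)
        have [measurable]: "time_average f (u n) \<in> borel_measurable F"
          by (rule measurable_time_average[OF u f_meas])
        have "(\<lambda>\<omega>. (time_average f (u n) \<omega> - c)\<^sup>2) \<in> borel_measurable (P x)"
          unfolding measurable_cong_sets[OF sets_P refl] by measurable
        then have "integrable (P x) (\<lambda>\<omega>. (time_average f (u n) \<omega> - c)\<^sup>2)"
          using b u by (intro integrable_const_bound[where B=b] AE_I2) auto
        then have "(\<integral>\<omega>. (time_average f (u n) \<omega> - c)\<^sup>2 \<partial>P x) \<le> b"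
          using b u by (intro integral_le_const) auto
        then show "norm (\<integral>\<omega>. (time_average f (u n) \<omega> - c)\<^sup>2 \<partial>P x) \<le> b" by simp
      qed
    qed auto
    then show "(\<lambda>n. \<integral>\<omega>. (time_average f (u n) \<omega> - c)\<^sup>2 \<partial>(\<mu> \<bind> P)) \<longlonglongrightarrow> 0"
      by (simp add: mixture[OF u])
  qed
  then have "Lp_converges (\<mu> \<bind> P) p T (time_average f) (\<lambda>_. c)" if "p \<ge> 1" for p
    using time_average_bounded[OF _ _ f_meas B] that
    by (intro bounded_Lp_converges[where b=B] prob_bind) (auto simp: space_bind)
  then show ?thesis
    by (simp add: mean_ergodic_def c_def time_average_def [abs_def])
qed

end

section \<open>Mean ergodicity for the four function classes\<close>

theorem corollary1p4:
  fixes T :: "real set" and \<tau> :: "real measure"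
    and F :: "'w measure" and Ft :: "real \<Rightarrow> 'w measure"
    and P :: "'s::polish_space \<Rightarrow> 'w measure"
    and \<theta> :: "real \<Rightarrow> 'w \<Rightarrow> 'w" and M :: "real \<Rightarrow> 'w \<Rightarrow> 's"
    and \<pi> :: "'s measure"
  assumes bounded_metric: "\<forall>x y :: 's. dist x y \<le> 1"
    and process: "markov_process T \<tau> F Ft P \<theta> M"
    and pi: "\<pi> \<in> space (prob_algebra borel)"
    and ergodic: "\<forall>x. ((\<lambda>t. SUP s\<in>T. \<integral>\<^sup>+ y. ennreal (d_W (transition P M t y) \<pi>) \<partial>transition P M s x)
                    \<longlongrightarrow> 0) (inf at_top (principal T))"
  shows
    "(\<forall>f\<in>C_c. \<forall>\<mu>\<in>space (prob_algebra borel). mean_ergodic T \<tau> P M \<pi> f \<mu>) \<and>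
     (compact (UNIV :: 's set) \<longrightarrow>
       (\<forall>f\<in>C. \<forall>\<mu>\<in>space (prob_algebra borel). mean_ergodic T \<tau> P M \<pi> f \<mu>)) \<and>
     (locally_compact_space (euclidean :: 's topology) \<longrightarrow>
       (\<forall>f\<in>C_infty. \<forall>\<mu>\<in>space (prob_algebra borel). mean_ergodic T \<tau> P M \<pi> f \<mu>)) \<and>
     ((\<exists>\<phi> :: 's \<Rightarrow> 'h::{real_inner, complete_space}. hilbert_structure \<phi>) \<longrightarrow>
       (\<forall>f\<in>C_bu. \<forall>\<mu>\<in>space (prob_algebra borel). mean_ergodic T \<tau> P M \<pi> f \<mu>))"
proof -
  interpret markov_process T \<tau> F Ft P \<theta> M by (rule process)
  \<comment> \<open>Every class lies in \<open>C_bu\<close>: \<open>C_c\<close> by way of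
    \<open>C_infty\<close>, and on a compact space \<open>C\<close> as well.\<close>
  have "mean_ergodic T \<tau> P M \<pi> f \<mu>" if "f \<in> C_bu" "\<mu> \<in> space (prob_algebra borel)" for f \<mu>
    by (rule mean_ergodic_C_bu[OF bounded_metric pi ergodic that])
  then show ?thesis
    using C_c_subset_C_infty C_subset_C_infty C_infty_subset_C_bu by blast
qed

end
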